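(* Let $K$ be a commutative ring with unit and let $S$ be an inverse semigroup with universal groupoid $\mathscr G(S)$. Then the homomorphism $\Theta\colon S\to K\mathscr G(S)$ given by $\Theta(s)=\chi_{(s,D(s^*s))}$ (a homomorphism into the multiplicative semigroup of $K\mathscr G(S)$) extends to an isomorphism of $K$-algebras $KS\cong K\mathscr G(S)$. Moreover, when $K=\mathbb C$, the map $\Theta$ extends to a $\ast$-isomorphism.
   Context: Inverse semigroups: a semigroup $S$ such that each $s\in S$ has a unique $s^*\in S$ with $ss^*s=s$, $s^*ss^*=s^*$. $E(S)$ is the commutative semigroup of idempotents, ordered by $e\le f$ iff $ef=e$; on $S$, $s\le t$ iff $s=et$ for some $e\in E(S)$. $KS$ is the semigroup algebra (free $K$-module with basis $S$ and product extending that of $S$); for $K=\mathbb C$, $(\sum c_s s)^*=\sum\overline{c_s}s^*$. Ample groupoids and their algebras: a groupoid $\mathscr G$ is a small category with all arrows invertible; objects are identified with units, $\mathscr G^0$ is the unit space, $d(g)=g^{-1}g$, $r(g)=gg^{-1}$, and $gh$ is defined iff $d(g)=r(h)$. "Compact" includes Hausdorff; locally compact spaces need not be Hausdorff. An étale groupoid is a topological groupoid with locally compact underlying space, with $\mathscr G^0$ locally compact Hausdorff, and with $d\colon\mathscr G\to\mathscr G^0$ a local homeomorphism ($\mathscr G$ need not be Hausdorff). A slice is an open $U\subseteq\mathscr G$ with $d|_U$ and $r|_U$ injective; $\mathscr G$ is ample if compact slices form a basis of its topology. Give $K$ the discrete topology. $K\mathscr G$ is the $K$-module of functions $\mathscr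 G\to K$ spanned by those $f$ for which there is an open Hausdorff subspace $V\subseteq \mathscr G$ such that $f$ vanishes outside $V$ and $f|_V$ is continuous with compact support. Its product is convolution $f\ast g(x)=\sum_{y\in d^{-1}(d(x))}f(xy^{-1})g(y)$. For $K=\mathbb C$, $f^*(x)=\overline{f(x^{-1})}$. Universal groupoid: $\widehat{E(S)}$ is the space of non-zero semilattice homomorphisms $\varphi\colon E(S)\to\{0,1\}$ with the subspace topology from $\{0,1\}^{E(S)}$; $D(e)=\{\varphi\mid\varphi(e)=1\}$. Each $s\in S$ acts by the homeomorphism $D(s^*s)\to D(ss^* )$, $(s\varphi)(e)=\varphi(s^*es)$. $\mathscr G(S)$ is the set of classes $[s,\varphi]$ of pairs $(s,\varphi)$ with $\varphi\in D(s^*s)$, where $(s,\varphi)\sim(t,\psi)$ iff $\varphi=\psi$ and there is $u\le s,t$ with $\varphi\in D(u^*u)$. A basis of the topology is given by the sets $(s,U)=\{[s,\varphi]\mid\varphi\in U\}$ with $U\subseteq D(s^*s)$ open. The product $[s,\varphi][t,\psi]=[st,\psi]$ is defined iff $t\psi=\varphi$, and $[s,\varphi]^{-1}=[s^*,s\varphi]$. The unit space is identified with $\widehat{E(S)}$, with $d([s,\varphi])=\varphi$ and $r([s,\varphi])=s\varphi$. This is an ample groupoid. $\chi_A$ denotes the characteristic function of $A$. *)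

theory Defs
  imports "HOL-Analysis.Analysis" "HOL-Library.Poly_Mapping"
begin

class inverse_semigroup = semigroup_mult +
  assumes ex1_sinv: "\<exists>!t. s * t * s = s \<and> t * s * t = t"

definition sinv :: "'s::inverse_semigroup \<Rightarrow> 's" where
  "sinv s = (THE t. s * t * s = s \<and> t * s * t = t)"

definition idempotents :: "'s::inverse_semigroup set" where
  "idempotents = {e. e * e = e}"

definition nat_le :: "'s::inverse_semigroup \<Rightarrow> 's \<Rightarrow> bool" where
  "nat_le s t \<longleftrightarrow> (\<exists>e\<in>idempotents. s = e * t)"

lemma sinv_props:
  fixes s :: "'s::inverse_semigroup"
  shows "s * sinv s * s = s" "sinv s * s * sinv s = sinv s"
  using theI'[OF ex1_sinv[of s]] unfolding sinv_def by blast+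

lemma sinv_props':
  fixes s :: "'s::inverse_semigroup"
  shows "s * (sinv s * s) = s" "sinv s * (s * sinv s) = sinv s"
  using sinv_props[of s] by (simp_all add: mult.assoc)

lemma sinv_props'':
  fixes s :: "'s::inverse_semigroup"
  shows "s * (sinv s * (s * z)) = s * z" "sinv s * (s * (sinv s * z)) = sinv s * z"
  using sinv_props[of s] by (simp_all add: mult.assoc[symmetric])

lemma sinv_unique:
  fixes s :: "'s::inverse_semigroup"
  assumes "s * t * s = s" "t * s * t = t"
  shows "t = sinv s"
  using ex1_sinv[of s] assms sinv_props[of s] by blast

lemma sinv_sinv [simp]: "sinv (sinv s) = s"
  using sinv_unique[of "sinv s" s] sinv_props[of s] by metis

lemma sinv_idem: "e \<in> idempotents \<Longrightarrow> sinv e = e"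
  using sinv_unique[of e e] by (simp add: idempotents_def)

lemma idem_sinv_mult [simp]: "sinv s * s \<in> idempotents" "s * sinv s \<in> idempotents"
  by (simp_all add: idempotents_def mult.assoc[symmetric] sinv_props)

lemma idem_mult [simp]:
  assumes "e \<in> idempotents" "f \<in> idempotents"
  shows "e * f \<in> idempotents"
proof -
  have e: "e * e = e" "\<And>z. e * (e * z) = e * z" 
    using assms by (auto simp: idempotents_def mult.assoc[symmetric])
  have f: "f * f = f" "\<And>z. f * (f * z) = f * z" 
    using assms by (auto simp: idempotents_def mult.assoc[symmetric])
  define x where "x = sinv (e * f)"
  have 1: "e * (f * (x * (e * f))) = e * f" and 2: "x * (e * (f * x)) = x"
    using sinv_props[of "e * f"] by (simp_all add: x_def mult.assoc)
  have h: "\<And>z. x * (e * (f * (x * z))) = x * z"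
    using 2 by (metis mult.assoc)
  have "f * x * e = sinv (e * f)"
    by (rule sinv_unique) (simp_all add: mult.assoc e f 1 h)
  then have x: "x = f * (x * e)" by (simp add: mult.assoc x_def)
  have "(f * (x * e)) * (f * (x * e)) = f * (x * e)"
    by (simp add: mult.assoc h)
  then have "x \<in> idempotents" unfolding x[symmetric] by (simp add: idempotents_def)
  moreover from this have "x = e * f"
    using sinv_idem sinv_sinv unfolding x_def by metis
  ultimately show ?thesis by simp
qed

lemma idem_commute:
  assumes "e \<in> idempotents" "f \<in> idempotents"
  shows "e * f = f * e"
proof -
  have e: "e * e = e" "\<And>z. e * (e * z) = e * z" 
    using assms by (auto simp: idempotents_def mult.assoc[symmetric])
  have f: "f * f = f" "\<And>z. f * (f * z) = f * z" 
    using assms by (auto simp: idempotents_def mult.assoc[symmetric])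
  have "e * (f * (e * f)) = e * f" "f * (e * (f * e)) = f * e"
    using idem_mult[OF assms] idem_mult[OF assms(2,1)]
    by (simp_all add: idempotents_def mult.assoc)
  then have "f * e = sinv (e * f)"
    by (intro sinv_unique) (simp_all add: mult.assoc e f)
  then show ?thesis using sinv_idem[OF idem_mult[OF assms]] by simp
qed

lemma sinv_mult: "sinv (s * t) = sinv t * sinv s"
proof -
  have c: "t * sinv t * (sinv s * s) = sinv s * s * (t * sinv t)"
    by (rule idem_commute) simp_all
  have "s * t * (sinv t * sinv s) * (s * t) = s * (t * sinv t * (sinv s * s)) * t"
    by (simp add: mult.assoc)
  also have "\<dots> = (s * sinv s * s) * (t * sinv t * t)"
    unfolding c by (simp add: mult.assoc)
  finally have 1: "s * t * (sinv t * sinv s) * (s * t) = s * t"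
    by (simp add: sinv_props)
  have "sinv t * sinv s * (s * t) * (sinv t * sinv s) = sinv t * (sinv s * s * (t * sinv t)) * sinv s"
    by (simp add: mult.assoc)
  also have "\<dots> = (sinv t * t * sinv t) * (sinv s * s * sinv s)"
    unfolding c[symmetric] by (simp add: mult.assoc)
  finally have 2: "sinv t * sinv s * (s * t) * (sinv t * sinv s) = sinv t * sinv s"
    by (simp add: sinv_props)
  show ?thesis using sinv_unique[OF 1 2] by simp
qed

lemma idem_conj [simp]:
  assumes "e \<in> idempotents"
  shows "sinv s * e * s \<in> idempotents"
proof -
  have "sinv s * e * s * (sinv s * e * s) = sinv s * (e * (s * sinv s)) * e * s"
    by (simp add: mult.assoc)
  also have "\<dots> = (sinv s * s * sinv s) * (e * e) * s"
    unfolding idem_commute[OF assms idem_sinv_mult(2)] by (simp add: mult.assoc)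
  finally show ?thesis using assms by (simp add: idempotents_def sinv_props)
qed

lemma idem_conj_mult:
  assumes "e \<in> idempotents" "f \<in> idempotents"
  shows "sinv s * (e * f) * s = (sinv s * e * s) * (sinv s * f * s)"
proof -
  have "(sinv s * e * s) * (sinv s * f * s) = sinv s * (e * (s * sinv s)) * f * s"
    by (simp add: mult.assoc)
  also have "\<dots> = (sinv s * s * sinv s) * e * f * s"
    unfolding idem_commute[OF assms(1) idem_sinv_mult(2)] by (simp add: mult.assoc)
  finally show ?thesis by (simp add: sinv_props'' mult.assoc)
qed

lemma nat_le_refl [simp]: "nat_le s s"
  unfolding nat_le_def by (metis idem_sinv_mult(2) sinv_props(1))

lemma nat_le_mult:
  assumes "nat_le u s" "nat_le v t"
  shows "nat_le (u * v) (s * t)"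
proof -
  obtain e f where ef: "e \<in> idempotents" "f \<in> idempotents" "u = e * s" "v = f * t"
    using assms by (auto simp: nat_le_def)
  have "u * v = e * (s * (sinv s * s) * f) * t"
    using ef by (simp add: mult.assoc sinv_props')
  also have "\<dots> = e * (s * (f * (sinv s * s))) * t"
    using idem_commute[OF ef(2) idem_sinv_mult(1)[of s]] by (simp add: mult.assoc)
  also have "\<dots> = (e * (sinv (sinv s) * f * sinv s)) * (s * t)"
    by (simp add: mult.assoc)
  finally show ?thesis
    using idem_mult[OF ef(1) idem_conj[OF ef(2), of "sinv s"]] unfolding nat_le_def by blast
qed

lemma nat_le_sinv:
  assumes "nat_le u s"
  shows "nat_le (sinv u) (sinv s)"
proof -
  obtain e where e: "e \<in> idempotents" "u = e * s"
    using assms by (auto simp: nat_le_def)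
  have "sinv u = sinv s * e"
    using e by (simp add: sinv_mult sinv_idem)
  also have "\<dots> = sinv s * (e * (s * sinv s))"
    using idem_commute[OF e(1) idem_sinv_mult(2)[of s]] sinv_props(2)[of s]
    by (metis mult.assoc)
  also have "\<dots> = (sinv s * e * s) * sinv s"
    by (simp add: mult.assoc)
  finally show ?thesis using e idem_conj[of e s] unfolding nat_le_def by blast
qed

text \<open>
  The coefficient rings have sort \<open>{comm_ring, comm_monoid_mult}\<close>: commutative rings with
  unit, without the axiom \<open>0 \<noteq> 1\<close> of \<open>comm_ring_1\<close>. The underlying module of \<open>KS\<close> is
  \<open>'s \<Rightarrow>\<^sub>0 'k\<close>, with the element \<open>s\<close> of the basis represented by \<open>single s 1\<close>.
\<close>

definition sa_scale :: "'k::comm_ring \<Rightarrow> ('s \<Rightarrow>\<^sub>0 'k) \<Rightarrow> ('s \<Rightarrow>\<^sub>0 'k)" where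
  "sa_scale c p = Poly_Mapping.map (\<lambda>a. c * a) p"

definition sa_mult :: "('s::inverse_semigroup \<Rightarrow>\<^sub>0 'k::comm_ring) \<Rightarrow> ('s \<Rightarrow>\<^sub>0 'k) \<Rightarrow> ('s \<Rightarrow>\<^sub>0 'k)" where
  "sa_mult p q = (\<Sum>s\<in>Poly_Mapping.keys p. \<Sum>t\<in>Poly_Mapping.keys q.
     Poly_Mapping.single (s * t) (Poly_Mapping.lookup p s * Poly_Mapping.lookup q t))"

definition sa_star :: "('s::inverse_semigroup \<Rightarrow>\<^sub>0 complex) \<Rightarrow> ('s \<Rightarrow>\<^sub>0 complex)" where
  "sa_star p = (\<Sum>s\<in>Poly_Mapping.keys p.
     Poly_Mapping.single (sinv s) (cnj (Poly_Mapping.lookup p s)))"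

text \<open>
  The set of arrows is the topspace of \<open>gtop\<close>; \<open>gmult\<close> and \<open>ginv\<close> are only meaningful on
  composable pairs of arrows and on arrows, respectively.
\<close>

record 'g top_groupoid =
  gtop :: "'g topology"
  gmult :: "'g \<Rightarrow> 'g \<Rightarrow> 'g"
  ginv :: "'g \<Rightarrow> 'g"

definition arrows :: "'g top_groupoid \<Rightarrow> 'g set" where
  "arrows G = topspace (gtop G)"

definition gdom :: "'g top_groupoid \<Rightarrow> 'g \<Rightarrow> 'g" where
  "gdom G g = gmult G (ginv G g) g"

text \<open>
  A function on the arrows is represented by a function on the whole type that is zero outside
  the set of arrows.
\<close>

definition ga_generators :: "'g top_groupoid \<Rightarrow> ('g \<Rightarrow> 'k::comm_ring) set" where
  "ga_generators G = {f. \<exists>V. openin (gtop G) V \<and> Hausdorff_space (subtopology (gtop G) V) \<and>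
     (\<forall>x. x \<notin> V \<longrightarrow> f x = 0) \<and>
     continuous_map (subtopology (gtop G) V) (discrete_topology UNIV) f \<and>
     compactin (subtopology (gtop G) V) (subtopology (gtop G) V closure_of {x \<in> V. f x \<noteq> 0})}"

definition ga_carrier :: "'g top_groupoid \<Rightarrow> ('g \<Rightarrow> 'k::comm_ring) set" where
  "ga_carrier G = {f. \<exists>A c. finite A \<and> A \<subseteq> ga_generators G \<and> f = (\<lambda>x. \<Sum>a\<in>A. c a * a x)}"

text \<open>
  In the convolution sum only finitely many terms are non-zero when the factors lie in
  \<open>ga_carrier G\<close>; the sum is restricted to these, as the fibre itself may be infinite.
\<close>

definition convolution :: "'g top_groupoid \<Rightarrow> ('g \<Rightarrow> 'k::comm_ring) \<Rightarrow> ('g \<Rightarrow> 'k) \<Rightarrow> 'g \<Rightarrow> 'k" where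
  "convolution G f g x = (if x \<in> arrows G then
     (\<Sum>y \<in> {y \<in> arrows G. gdom G y = gdom G x \<and> f (gmult G x (ginv G y)) * g y \<noteq> 0}.
        f (gmult G x (ginv G y)) * g y) else 0)"

definition ga_star :: "'g top_groupoid \<Rightarrow> ('g \<Rightarrow> complex) \<Rightarrow> 'g \<Rightarrow> complex" where
  "ga_star G f x = (if x \<in> arrows G then cnj (f (ginv G x)) else 0)"

definition char_fun :: "'g set \<Rightarrow> 'g \<Rightarrow> 'k::{comm_ring, comm_monoid_mult}" where
  "char_fun A x = (if x \<in> A then 1 else 0)"

text \<open>
  \<open>{0,1}\<close> is rendered by \<open>bool\<close>, with meet \<open>\<and>\<close>. Characters are extensional functions on
  the set of idempotents, that is, points of the library's \<open>product_topology\<close>.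
\<close>

definition spectrum :: "('s::inverse_semigroup \<Rightarrow> bool) set" where
  "spectrum = {\<phi> \<in> extensional idempotents.
     (\<forall>e\<in>idempotents. \<forall>f\<in>idempotents. \<phi> (e * f) \<longleftrightarrow> \<phi> e \<and> \<phi> f) \<and> (\<exists>e\<in>idempotents. \<phi> e)}"

definition spectrum_top :: "('s::inverse_semigroup \<Rightarrow> bool) topology" where
  "spectrum_top = subtopology (product_topology (\<lambda>_. discrete_topology UNIV) idempotents) spectrum"

definition spec_D :: "'s::inverse_semigroup \<Rightarrow> ('s \<Rightarrow> bool) set" where
  "spec_D e = {\<phi> \<in> spectrum. \<phi> e}"

definition spec_act :: "'s::inverse_semigroup \<Rightarrow> ('s \<Rightarrow> bool) \<Rightarrow> ('s \<Rightarrow> bool)" where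
  "spec_act s \<phi> = (\<lambda>e\<in>idempotents. \<phi> (sinv s * e * s))"

type_synonym 's germ = "('s \<times> ('s \<Rightarrow> bool)) set"

definition germ_pairs :: "('s::inverse_semigroup \<times> ('s \<Rightarrow> bool)) set" where
  "germ_pairs = {(s, \<phi>). \<phi> \<in> spec_D (sinv s * s)}"

definition germ_rel :: "(('s::inverse_semigroup \<times> ('s \<Rightarrow> bool)) \<times> ('s \<times> ('s \<Rightarrow> bool))) set" where
  "germ_rel = {((s, \<phi>), (t, \<psi>)). (s, \<phi>) \<in> germ_pairs \<and> (t, \<psi>) \<in> germ_pairs \<and> \<phi> = \<psi> \<and>
     (\<exists>u. nat_le u s \<and> nat_le u t \<and> \<phi> \<in> spec_D (sinv u * u))}"

definition germ :: "'s::inverse_semigroup \<Rightarrow> ('s \<Rightarrow> bool) \<Rightarrow> 's germ" where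
  "germ s \<phi> = germ_rel `` {(s, \<phi>)}"

definition germs :: "'s::inverse_semigroup germ set" where
  "germs = germ_pairs // germ_rel"

definition germ_slice :: "'s::inverse_semigroup \<Rightarrow> ('s \<Rightarrow> bool) set \<Rightarrow> 's germ set" where
  "germ_slice s U = germ s ` U"

definition germ_basis :: "'s::inverse_semigroup germ set set" where
  "germ_basis = {germ_slice s U | s U. openin spectrum_top U \<and> U \<subseteq> spec_D (sinv s * s)}"

text \<open>The following descriptions are justified by the lemmas \<open>germ_mult_germ\<close> and
  \<open>germ_inv_germ\<close>. By \<open>gdom_germ_eq_iff\<close>, the source of the germ of \<open>s\<close> at \<open>\<phi>\<close>
  may be identified with \<open>\<phi>\<close>, and by \<open>openin_universal_groupoid\<close> the generating family
  of the topology is a basis.\<close>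

definition germ_mult :: "'s::inverse_semigroup germ \<Rightarrow> 's germ \<Rightarrow> 's germ" where
  "germ_mult g h = (THE k. \<exists>s \<phi> t \<psi>. (s, \<phi>) \<in> germ_pairs \<and> (t, \<psi>) \<in> germ_pairs \<and>
     g = germ s \<phi> \<and> h = germ t \<psi> \<and> spec_act t \<psi> = \<phi> \<and> k = germ (s * t) \<psi>)"

definition germ_inv :: "'s::inverse_semigroup germ \<Rightarrow> 's germ" where
  "germ_inv g = (THE k. \<exists>s \<phi>. (s, \<phi>) \<in> germ_pairs \<and> g = germ s \<phi> \<and> k = germ (sinv s) (spec_act s \<phi>))"

definition universal_groupoid :: "'s::inverse_semigroup germ top_groupoid" where
  "universal_groupoid =
     \<lparr>gtop = topology_generated_by germ_basis, gmult = germ_mult, ginv = germ_inv\<rparr>"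

definition Theta :: "'s::inverse_semigroup \<Rightarrow> 's germ \<Rightarrow> 'k::{comm_ring, comm_monoid_mult}" where
  "Theta s = char_fun (germ_slice s (spec_D (sinv s * s)))"

text \<open>Since \<open>KS\<close> and the groupoid algebra need not have a unit, none is required to be preserved.\<close>

definition algebra_iso ::
  "'g top_groupoid \<Rightarrow> (('s::inverse_semigroup \<Rightarrow>\<^sub>0 'k::comm_ring) \<Rightarrow> 'g \<Rightarrow> 'k) \<Rightarrow> bool" where
  "algebra_iso G \<Phi> \<longleftrightarrow> bij_betw \<Phi> UNIV (ga_carrier G) \<and>
     (\<forall>p q. \<Phi> (p + q) = (\<lambda>x. \<Phi> p x + \<Phi> q x)) \<and>
     (\<forall>c p. \<Phi> (sa_scale c p) = (\<lambda>x. c * \<Phi> p x)) \<and>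
     (\<forall>p q. \<Phi> (sa_mult p q) = convolution G (\<Phi> p) (\<Phi> q))"

lemma spec_act_mem:
  assumes "(s, \<phi>) \<in> germ_pairs"
  shows "spec_act s \<phi> \<in> spec_D (s * sinv s)"
proof -
  have \<phi>: "\<phi> \<in> spectrum" "\<phi> (sinv s * s)"
    using assms by (auto simp: germ_pairs_def spec_D_def)
  have 1: "spec_act s \<phi> (s * sinv s)"
    using \<phi> by (simp add: spec_act_def mult.assoc sinv_props')
  have "spec_act s \<phi> (e * f) \<longleftrightarrow> spec_act s \<phi> e \<and> spec_act s \<phi> f"
    if "e \<in> idempotents" "f \<in> idempotents" for e f
    using \<phi>(1) that idem_conj_mult[OF that, of s] by (simp add: spec_act_def spectrum_def)
  then have "spec_act s \<phi> \<in> spectrum"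
    using 1 unfolding spectrum_def by (auto simp: spec_act_def)
  with 1 show ?thesis by (simp add: spec_D_def)
qed

lemma nat_le_conj:
  assumes "nat_le v t" "e \<in> idempotents"
  shows "sinv v * e * v = (sinv v * v) * (sinv t * e * t)"
proof -
  obtain f where f: "f \<in> idempotents" "v = f * t"
    using assms by (auto simp: nat_le_def)
  have "f * (f * t) = f * t"
    using f by (simp add: idempotents_def mult.assoc[symmetric])
  then have v: "sinv v * v = sinv t * f * t"
    using f by (simp add: sinv_mult sinv_idem mult.assoc)
  have "sinv v * e * v = sinv t * (f * (e * f)) * t"
    using f by (simp add: sinv_mult sinv_idem mult.assoc)
  also have "f * (e * f) = f * e"
    using f(1) unfolding idem_commute[OF assms(2) f(1)]
    by (simp add: idempotents_def mult.assoc[symmetric])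
  also have "sinv t * (f * e) * t = (sinv v * v) * (sinv t * e * t)"
    using v idem_conj_mult[OF f(1) assms(2)] by simp
  finally show ?thesis .
qed

lemma spec_act_nat_le:
  assumes "nat_le v t" "\<phi> \<in> spec_D (sinv v * v)"
  shows "spec_act v \<phi> = spec_act t \<phi>"
proof -
  have "\<phi> (sinv v * e * v) = \<phi> (sinv t * e * t)" if "e \<in> idempotents" for e
    using assms(2) nat_le_conj[OF assms(1) that] that by (simp add: spec_D_def spectrum_def)
  then show ?thesis by (auto simp: spec_act_def restrict_def fun_eq_iff)
qed

lemma germ_pairs_mult:
  assumes "(s, spec_act t \<psi>) \<in> germ_pairs" "(t, \<psi>) \<in> germ_pairs"
  shows "(s * t, \<psi>) \<in> germ_pairs"
proof -
  have "spec_act t \<psi> (sinv s * s)"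
    using assms(1) by (simp add: germ_pairs_def spec_D_def)
  then have "\<psi> (sinv t * (sinv s * s) * t)"
    by (simp add: spec_act_def)
  moreover have "sinv (s * t) * (s * t) = sinv t * (sinv s * s) * t"
    by (simp add: sinv_mult mult.assoc)
  ultimately show ?thesis
    using assms(2) by (simp add: germ_pairs_def spec_D_def)
qed

lemma nat_le_D:
  assumes "nat_le u s" "\<phi> \<in> spec_D (sinv u * u)"
  shows "\<phi> \<in> spec_D (sinv s * s)"
proof -
  have "sinv u * (s * sinv s) * u = (sinv u * u) * (sinv s * s)"
    using nat_le_conj[OF assms(1) idem_sinv_mult(2)[of s]] by (simp add: mult.assoc sinv_props')
  moreover have "sinv u * (s * sinv s) * u = sinv u * u"
  proof -
    obtain e where e: "e \<in> idempotents" "u = e * s"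
      using assms by (auto simp: nat_le_def)
    have "s * sinv s * u = (s * sinv s * e) * s" using e by (simp add: mult.assoc)
    also have "\<dots> = e * (s * sinv s * s)"
      unfolding idem_commute[OF e(1) idem_sinv_mult(2)[of s], symmetric] by (simp add: mult.assoc)
    finally show ?thesis using e by (simp add: mult.assoc sinv_props')
  qed
  ultimately show ?thesis using assms(2) by (simp add: spec_D_def spectrum_def) (metis idem_sinv_mult(1))
qed

lemma equiv_germ_rel: "equiv germ_pairs germ_rel"
proof (rule equivI)
  show "germ_rel \<subseteq> germ_pairs \<times> germ_pairs" by (auto simp: germ_rel_def)
  show "refl_on germ_pairs germ_rel"
    unfolding refl_on_def by (auto simp: germ_rel_def germ_pairs_def intro: nat_le_refl)
  show "sym germ_rel" by (rule symI) (auto simp: germ_rel_def)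
  show "trans germ_rel"
  proof (rule transI, clarify)
    fix s \<phi> t \<psi> w \<xi>
    assume a: "((s, \<phi>), (t, \<psi>)) \<in> germ_rel" "((t, \<psi>), (w, \<xi>)) \<in> germ_rel"
    obtain u where u: "nat_le u s" "nat_le u t" "\<phi> \<in> spec_D (sinv u * u)" 
      using a(1) by (auto simp: germ_rel_def)
    obtain v where v: "nat_le v t" "nat_le v w" "\<psi> \<in> spec_D (sinv v * v)"
      using a(2) by (auto simp: germ_rel_def)
    have eq: "\<phi> = \<psi>" "\<psi> = \<xi>" using a by (auto simp: germ_rel_def)
    obtain e f where ef: "e \<in> idempotents" "f \<in> idempotents" "u = e * t" "v = f * t"
      using u(2) v(1) by (auto simp: nat_le_def)
    define z where "z = f * u"
    have "z = e * v" using ef idem_commute[of e f] by (metis z_def mult.assoc)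
    then have zs: "nat_le z s" and zw: "nat_le z w"
      using u(1) v(2) ef idem_mult unfolding nat_le_def z_def by (metis mult.assoc)+
    have zu: "nat_le z u" using ef by (auto simp: nat_le_def z_def)
    have "sinv z * z = sinv u * f * u"
      using ef by (simp add: z_def sinv_mult sinv_idem mult.assoc idempotents_def)
        (metis mult.assoc)
    also have "\<dots> = (sinv u * u) * (sinv v * v)"
    proof -
      have "sinv v * v = sinv t * f * t"
        using ef by (simp add: sinv_mult sinv_idem mult.assoc idempotents_def)
          (metis mult.assoc)
      then show ?thesis using nat_le_conj[OF u(2) ef(2)] by simp
    qed
    finally have "\<phi> \<in> spec_D (sinv z * z)"
      using u(3) v(3) eq by (simp add: spec_D_def spectrum_def)
    then show "((s, \<phi>), (w, \<xi>)) \<in> germ_rel"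
      using a zs zw eq by (auto simp: germ_rel_def)
  qed
qed

lemma germ_eq_iff:
  assumes "(s, \<phi>) \<in> germ_pairs" "(t, \<psi>) \<in> germ_pairs"
  shows "germ s \<phi> = germ t \<psi> \<longleftrightarrow> ((s, \<phi>), (t, \<psi>)) \<in> germ_rel"
  unfolding germ_def using eq_equiv_class_iff[OF equiv_germ_rel assms] .

lemma germ_mult_germ:
  assumes "(s, \<phi>) \<in> germ_pairs" "(t, \<psi>) \<in> germ_pairs" "spec_act t \<psi> = \<phi>"
  shows "germ_mult (germ s \<phi>) (germ t \<psi>) = germ (s * t) \<psi>"
  unfolding germ_mult_def
proof (rule the_equality)
  show "\<exists>s' \<phi>' t' \<psi>'. (s', \<phi>') \<in> germ_pairs \<and> (t', \<psi>') \<in> germ_pairs \<and> germ s \<phi> = germ s' \<phi>' \<and>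
    germ t \<psi> = germ t' \<psi>' \<and> spec_act t' \<psi>' = \<phi>' \<and> germ (s * t) \<psi> = germ (s' * t') \<psi>'"
    using assms by blast
next
  fix k
  assume "\<exists>s' \<phi>' t' \<psi>'. (s', \<phi>') \<in> germ_pairs \<and> (t', \<psi>') \<in> germ_pairs \<and> germ s \<phi> = germ s' \<phi>' \<and>
    germ t \<psi> = germ t' \<psi>' \<and> spec_act t' \<psi>' = \<phi>' \<and> k = germ (s' * t') \<psi>'"
  then obtain s' \<phi>' t' \<psi>' where k: "(s', \<phi>') \<in> germ_pairs" "(t', \<psi>') \<in> germ_pairs"
    "germ s \<phi> = germ s' \<phi>'" "germ t \<psi> = germ t' \<psi>'" "spec_act t' \<psi>' = \<phi>'" "k = germ (s' * t') \<psi>'"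
    by blast
  have r: "((s, \<phi>), (s', \<phi>')) \<in> germ_rel" "((t, \<psi>), (t', \<psi>')) \<in> germ_rel"
    using k assms germ_eq_iff by metis+
  then have eq: "\<phi>' = \<phi>" "\<psi>' = \<psi>" by (auto simp: germ_rel_def)
  obtain u where u: "nat_le u s" "nat_le u s'" "\<phi> \<in> spec_D (sinv u * u)"
    using r(1) by (auto simp: germ_rel_def)
  obtain v where v: "nat_le v t" "nat_le v t'" "\<psi> \<in> spec_D (sinv v * v)"
    using r(2) by (auto simp: germ_rel_def)
  have "(u * v, \<psi>) \<in> germ_pairs"
    using u(3) v(3) spec_act_nat_le[OF v(1,3)] assms(3)
    by (intro germ_pairs_mult) (auto simp: germ_pairs_def)
  then have "((s * t, \<psi>), (s' * t', \<psi>)) \<in> germ_rel"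
    using nat_le_mult[OF u(1) v(1)] nat_le_mult[OF u(2) v(2)] germ_pairs_mult[of s t \<psi>]
      germ_pairs_mult[of s' t' \<psi>] assms k(1,2,5) eq
    by (auto simp: germ_rel_def) (auto simp: germ_pairs_def)
  then have "germ (s * t) \<psi> = germ (s' * t') \<psi>"
    using equiv_class_eq[OF equiv_germ_rel] by (simp add: germ_def)
  then show "k = germ (s * t) \<psi>" using k eq by simp
qed

lemma germ_inv_germ:
  assumes "(s, \<phi>) \<in> germ_pairs"
  shows "germ_inv (germ s \<phi>) = germ (sinv s) (spec_act s \<phi>)"
  unfolding germ_inv_def
proof (rule the_equality)
  show "\<exists>s' \<phi>'. (s', \<phi>') \<in> germ_pairs \<and> germ s \<phi> = germ s' \<phi>' \<and>
    germ (sinv s) (spec_act s \<phi>) = germ (sinv s') (spec_act s' \<phi>')"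
    using assms by blast
next
  fix k
  assume "\<exists>s' \<phi>'. (s', \<phi>') \<in> germ_pairs \<and> germ s \<phi> = germ s' \<phi>' \<and> k = germ (sinv s') (spec_act s' \<phi>')"
  then obtain s' \<phi>' where k: "(s', \<phi>') \<in> germ_pairs" "germ s \<phi> = germ s' \<phi>'"
    "k = germ (sinv s') (spec_act s' \<phi>')" by blast
  have r: "((s, \<phi>), (s', \<phi>')) \<in> germ_rel"
    using k assms germ_eq_iff by metis
  then have eq: "\<phi>' = \<phi>" by (auto simp: germ_rel_def)
  obtain u where u: "nat_le u s" "nat_le u s'" "\<phi> \<in> spec_D (sinv u * u)"
    using r by (auto simp: germ_rel_def)
  have act: "spec_act s \<phi> = spec_act u \<phi>" "spec_act s' \<phi> = spec_act u \<phi>"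
    using spec_act_nat_le u by metis+
  have "spec_act u \<phi> \<in> spec_D (u * sinv u)"
    using u by (intro spec_act_mem) (auto simp: germ_pairs_def)
  moreover have "spec_act s \<phi> \<in> spec_D (s * sinv s)" "spec_act s' \<phi>' \<in> spec_D (s' * sinv s')"
    using assms k spec_act_mem by auto
  ultimately have "((sinv s, spec_act s \<phi>), (sinv s', spec_act s' \<phi>')) \<in> germ_rel"
    using nat_le_sinv[OF u(1)] nat_le_sinv[OF u(2)] act eq
    by (auto simp: germ_rel_def germ_pairs_def intro!: exI[of _ "sinv u"])
  then show "k = germ (sinv s) (spec_act s \<phi>)"
    using equiv_class_eq[OF equiv_germ_rel, symmetric] k(3) by (simp add: germ_def)
qed

lemma gdom_germ:
  assumes "(s, \<phi>) \<in> germ_pairs"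
  shows "gdom universal_groupoid (germ s \<phi>) = germ (sinv s * s) \<phi>"
proof -
  have "(sinv s, spec_act s \<phi>) \<in> germ_pairs"
    using spec_act_mem[OF assms] by (simp add: germ_pairs_def)
  from germ_mult_germ[OF this assms refl] show ?thesis
    unfolding gdom_def universal_groupoid_def top_groupoid.simps germ_inv_germ[OF assms] .
qed

lemma gdom_germ_eq_iff:
  assumes "(s, \<phi>) \<in> germ_pairs" "(t, \<psi>) \<in> germ_pairs"
  shows "gdom universal_groupoid (germ s \<phi>) = gdom universal_groupoid (germ t \<psi>) \<longleftrightarrow> \<phi> = \<psi>"
proof -
  have sq: "sinv e * e = e" if "e \<in> idempotents" for e :: 'a
    using that sinv_idem[OF that] by (simp add: idempotents_def)
  have p: "(sinv s * s, \<phi>) \<in> germ_pairs" "(sinv t * t, \<psi>) \<in> germ_pairs"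
    unfolding germ_pairs_def using assms
    by (simp_all only: sq[OF idem_sinv_mult(1)] mem_Collect_eq case_prod_conv germ_pairs_def)
  define u where "u = (sinv s * s) * (sinv t * t)"
  have u: "u \<in> idempotents" by (simp add: u_def)
  have le: "nat_le u (sinv s * s)" "nat_le u (sinv t * t)"
    unfolding nat_le_def u_def
    using idem_commute[OF idem_sinv_mult(1)[of s] idem_sinv_mult(1)[of t]] idem_sinv_mult(1)
    by blast+
  have "((sinv s * s, \<phi>), (sinv t * t, \<psi>)) \<in> germ_rel \<longleftrightarrow> \<phi> = \<psi>"
  proof
    assume eq: "\<phi> = \<psi>"
    have "\<phi> \<in> spec_D (sinv u * u)"
      using assms eq unfolding sq[OF u] unfolding u_def by (simp add: germ_pairs_def spec_D_def spectrum_def)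
    then show "((sinv s * s, \<phi>), (sinv t * t, \<psi>)) \<in> germ_rel"
      using p le eq unfolding germ_rel_def by blast
  qed (auto simp: germ_rel_def)
  then show ?thesis
    unfolding gdom_germ[OF assms(1)] gdom_germ[OF assms(2)] germ_eq_iff[OF p] .
qed

lemma topspace_spectrum_top: "topspace spectrum_top = spectrum"
  by (auto simp: spectrum_top_def spectrum_def PiE_def)

lemma openin_spec_D:
  assumes "e \<in> idempotents"
  shows "openin spectrum_top (spec_D e)"
proof -
  have "continuous_map spectrum_top (discrete_topology UNIV) (\<lambda>\<phi>. \<phi> e)"
    unfolding spectrum_top_def using assms
    by (intro continuous_map_from_subtopology continuous_map_product_projection)
  then have "openin spectrum_top {\<phi> \<in> topspace spectrum_top. \<phi> e \<in> {True}}"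
    by (intro openin_continuous_map_preimage) auto
  then show ?thesis by (simp add: topspace_spectrum_top spec_D_def)
qed

lemma germ_in_slice_iff:
  assumes "U \<subseteq> spec_D (sinv s * s)" "(t, \<psi>) \<in> germ_pairs"
  shows "germ t \<psi> \<in> germ_slice s U \<longleftrightarrow> \<psi> \<in> U \<and> ((s, \<psi>), (t, \<psi>)) \<in> germ_rel"
proof
  assume "germ t \<psi> \<in> germ_slice s U"
  then obtain \<phi> where \<phi>: "\<phi> \<in> U" "germ t \<psi> = germ s \<phi>" by (auto simp: germ_slice_def)
  have "(s, \<phi>) \<in> germ_pairs" using \<phi> assms by (auto simp: germ_pairs_def)
  then have "((s, \<phi>), (t, \<psi>)) \<in> germ_rel" using \<phi> assms germ_eq_iff by metis
  then show "\<psi> \<in> U \<and> ((s, \<psi>), (t, \<psi>)) \<in> germ_rel" using \<phi> by (auto simp: germ_rel_def)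
next
  assume "\<psi> \<in> U \<and> ((s, \<psi>), (t, \<psi>)) \<in> germ_rel"
  then show "germ t \<psi> \<in> germ_slice s U"
    using assms germ_eq_iff[of s \<psi> t \<psi>] by (auto simp: germ_slice_def germ_rel_def)
qed

lemma germ_basis_Int:
  assumes "A \<in> germ_basis" "B \<in> germ_basis" "x \<in> A \<inter> B"
  shows "\<exists>C\<in>germ_basis. x \<in> C \<and> C \<subseteq> A \<inter> B"
proof -
  obtain s U where A: "A = germ_slice s U" "openin spectrum_top U" "U \<subseteq> spec_D (sinv s * s)"
    using assms by (auto simp: germ_basis_def)
  obtain t V where B: "B = germ_slice t V" "openin spectrum_top V" "V \<subseteq> spec_D (sinv t * t)"
    using assms by (auto simp: germ_basis_def)
  obtain \<phi> where x: "x = germ s \<phi>" "\<phi> \<in> U"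
    using assms A by (auto simp: germ_slice_def)
  have p: "(s, \<phi>) \<in> germ_pairs" using x A by (auto simp: germ_pairs_def)
  have xt: "\<phi> \<in> V" "((t, \<phi>), (s, \<phi>)) \<in> germ_rel"
    using germ_in_slice_iff[OF B(3) p] assms B x by auto
  then obtain u where u: "nat_le u s" "nat_le u t" "\<phi> \<in> spec_D (sinv u * u)"
    by (auto simp: germ_rel_def)
  define W where "W = U \<inter> V \<inter> spec_D (sinv u * u)"
  have W: "openin spectrum_top W" "W \<subseteq> spec_D (sinv u * u)"
    using A B by (auto simp: W_def intro!: openin_Int openin_spec_D)
  have rel: "((r, \<psi>), (u, \<psi>)) \<in> germ_rel" if "nat_le u r" "\<psi> \<in> W" for r \<psi>
    using that W nat_le_D[OF that(1), of \<psi>] by (auto simp: germ_rel_def germ_pairs_def)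
  have "germ_slice u W \<subseteq> A \<inter> B"
  proof
    fix y assume "y \<in> germ_slice u W"
    then obtain \<psi> where \<psi>: "\<psi> \<in> W" "y = germ u \<psi>" by (auto simp: germ_slice_def)
    have "(u, \<psi>) \<in> germ_pairs" using \<psi> W by (auto simp: germ_pairs_def)
    then show "y \<in> A \<inter> B"
      using germ_in_slice_iff[OF A(3)] germ_in_slice_iff[OF B(3)] rel[OF u(1) \<psi>(1)]
        rel[OF u(2) \<psi>(1)] \<psi> A B by (auto simp: W_def)
  qed
  moreover have "x \<in> germ_slice u W"
  proof -
    have "\<phi> \<in> W" using x xt u by (simp add: W_def)
    moreover from this have "((u, \<phi>), (s, \<phi>)) \<in> germ_rel"
      using rel[OF u(1)] equiv_germ_rel by (meson equivE symD)
    ultimately show ?thesis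
      using germ_in_slice_iff[OF W(2) p] x by simp
  qed
  ultimately show ?thesis using W by (auto simp: germ_basis_def)
qed

lemma openin_universal_groupoid:
  "openin (gtop universal_groupoid) X \<longleftrightarrow> (\<forall>x\<in>X. \<exists>B\<in>germ_basis. x \<in> B \<and> B \<subseteq> X)"
proof
  assume "openin (gtop universal_groupoid) X"
  then have "generate_topology_on germ_basis X"
    by (simp add: universal_groupoid_def openin_topology_generated_by)
  then show "\<forall>x\<in>X. \<exists>B\<in>germ_basis. x \<in> B \<and> B \<subseteq> X"
  proof induction
    case (Int a b)
    show ?case
    proof
      fix x assume "x \<in> a \<inter> b"
      then have "x \<in> a" "x \<in> b" by auto
      then obtain A B where AB: "A \<in> germ_basis" "x \<in> A" "A \<subseteq> a" "B \<in> germ_basis" "x \<in> B" "B \<subseteq> b"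
        using Int.IH by meson
      then obtain C where "C \<in> germ_basis" "x \<in> C" "C \<subseteq> A \<inter> B"
        using germ_basis_Int[of A B x] by auto
      with AB show "\<exists>C\<in>germ_basis. x \<in> C \<and> C \<subseteq> a \<inter> b"
        by (intro bexI[of _ C]) auto
    qed
  next
    case (UN K)
    show ?case
    proof
      fix x assume "x \<in> \<Union>K"
      then obtain k where k: "k \<in> K" "x \<in> k" by blast
      then obtain B where "B \<in> germ_basis" "x \<in> B" "B \<subseteq> k"
        using UN.IH by meson
      with k show "\<exists>B\<in>germ_basis. x \<in> B \<and> B \<subseteq> \<Union>K"
        by (intro bexI[of _ B]) auto
    qed
  qed auto
next
  assume R: "\<forall>x\<in>X. \<exists>B\<in>germ_basis. x \<in> B \<and> B \<subseteq> X"
  have "X = \<Union>{B \<in> germ_basis. B \<subseteq> X}" using R by blast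
  moreover have "openin (gtop universal_groupoid) (\<Union>{B \<in> germ_basis. B \<subseteq> X})"
    by (rule openin_Union) (auto simp: universal_groupoid_def intro: topology_generated_by_Basis)
  ultimately show "openin (gtop universal_groupoid) X" by simp
qed

lemma arrows_universal_groupoid: "arrows universal_groupoid = germs"
proof -
  have "\<Union>germ_basis = germs"
  proof (intro equalityI subsetI)
    fix x assume "x \<in> \<Union>germ_basis"
    then show "x \<in> germs"
      by (auto simp: germ_basis_def germ_slice_def germs_def germ_def germ_pairs_def intro!: quotientI)
  next
    fix x assume "x \<in> germs"
    then obtain s \<phi> where x: "x = germ s \<phi>" "\<phi> \<in> spec_D (sinv s * s)"
      by (auto simp: germs_def germ_def germ_pairs_def elim!: quotientE)
    have "germ_slice s (spec_D (sinv s * s)) \<in> germ_basis"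
      using openin_spec_D[OF idem_sinv_mult(1)[of s]] by (auto simp: germ_basis_def)
    then show "x \<in> \<Union>germ_basis" using x unfolding germ_slice_def by blast
  qed
  then show ?thesis
    by (simp add: arrows_def universal_groupoid_def topology_generated_by_topspace)
qed

end

theory Submission
  imports Defs
begin

text \<open>
  Injectivity: if \<open>s\<close> is maximal, for the natural order, in the support of an element of \<open>KS\<close>, then
  evaluation at the germ of \<open>s\<close> at the principal character of \<open>s\<^sup>*s\<close> sees only those basis elements
  \<open>t \<ge> s\<close>, and so returns the coefficient of \<open>s\<close>.

  Surjectivity: call a set of characters stable if cutting functions down to the germs whose source
  lies in it preserves the span of the \<open>\<Theta>(s)\<close>. Stable sets form a Boolean algebra, and \<open>D(e)\<close> is
  stable because cutting \<open>\<Theta>(s)\<close> down to \<open>D(e)\<close> yields \<open>\<Theta>(se)\<close>. Hence all compact open sets of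
  characters are stable, and the span contains the characteristic functions of all compact open
  slices. A generator of the groupoid algebra is locally constant with compact support inside a
  Hausdorff open set, so it is a combination of finitely many of these.
\<close>

section \<open>Germs and restriction to idempotents\<close>

lemma germs_cases:
  assumes "x \<in> germs"
  obtains s \<phi> where "(s, \<phi>) \<in> germ_pairs" "x = germ s \<phi>"
  using assms by (auto simp: germs_def germ_def elim!: quotientE)

lemma germ_in_germs: "(s, \<phi>) \<in> germ_pairs \<Longrightarrow> germ s \<phi> \<in> germs"
  by (auto simp: germs_def germ_def intro: quotientI)

lemma germ_eq_imp_char_eq:
  assumes "germ s \<phi> = germ t \<psi>" "(s, \<phi>) \<in> germ_pairs" "(t, \<psi>) \<in> germ_pairs"
  shows "\<phi> = \<psi>"
  using germ_eq_iff[OF assms(2,3)] assms(1) by (simp add: germ_rel_def)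

text \<open>The element \<open>u\<close> itself serves as the common lower bound of \<open>s\<close>
  and \<open>u\<close> that \<open>germ_rel\<close> asks for.\<close>

lemma germ_nat_le:
  assumes "nat_le u s" "(u, \<phi>) \<in> germ_pairs"
  shows "(s, \<phi>) \<in> germ_pairs" "germ s \<phi> = germ u \<phi>"
proof -
  show s: "(s, \<phi>) \<in> germ_pairs"
    using nat_le_D[OF assms(1)] assms(2) by (simp add: germ_pairs_def)
  show "germ s \<phi> = germ u \<phi>"
    unfolding germ_eq_iff[OF s assms(2)]
    using s assms nat_le_refl by (auto simp: germ_rel_def germ_pairs_def)
qed

lemma germ_eq_iff_nat_le:
  assumes "(s, \<phi>) \<in> germ_pairs" "(t, \<phi>) \<in> germ_pairs"
  shows "germ s \<phi> = germ t \<phi> \<longleftrightarrow> (\<exists>u. nat_le u s \<and> nat_le u t \<and> (u, \<phi>) \<in> germ_pairs)"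
  unfolding germ_eq_iff[OF assms] using assms by (auto simp: germ_rel_def germ_pairs_def)

lemma sinv_mult_idem [simp]:
  assumes "e \<in> idempotents"
  shows "sinv e * e = e"
  using assms by (simp add: sinv_idem idempotents_def)

text \<open>Conjugation moves an idempotent from the right to the left:
  \<open>s * e = (s * e * sinv s) * s\<close>.\<close>

lemma nat_le_mult_idem:
  assumes "e \<in> idempotents"
  shows "nat_le (s * e) s"
proof -
  have "s * e = s * (sinv s * s * e)"
    by (simp add: mult.assoc sinv_props'')
  also have "\<dots> = (sinv (sinv s) * e * sinv s) * s"
    unfolding idem_commute[OF idem_sinv_mult(1) assms] by (simp add: mult.assoc)
  finally show ?thesis
    using idem_conj[OF assms, of "sinv s"] unfolding nat_le_def by blast
qed

lemma char_mult_iff: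
  assumes "\<phi> \<in> spectrum" "e \<in> idempotents" "f \<in> idempotents"
  shows "\<phi> (e * f) \<longleftrightarrow> \<phi> e \<and> \<phi> f"
  using assms by (auto simp: spectrum_def)

lemma sinv_mult_restrict:
  assumes "e \<in> idempotents"
  shows "sinv (s * e) * (s * e) = sinv s * s * e"
proof -
  have "sinv (s * e) * (s * e) = e * (sinv s * s * e)"
    using assms by (simp add: sinv_mult sinv_idem mult.assoc)
  also have "\<dots> = (e * e) * (sinv s * s)"
    unfolding idem_commute[OF idem_sinv_mult(1) assms] by (simp only: mult.assoc)
  also have "\<dots> = sinv s * s * e"
    unfolding idem_commute[OF idem_sinv_mult(1) assms] using assms by (simp add: idempotents_def)
  finally show ?thesis .
qed

lemma germ_pairs_mult_idem_iff:
  assumes "e \<in> idempotents"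
  shows "(s * e, \<phi>) \<in> germ_pairs \<longleftrightarrow> (s, \<phi>) \<in> germ_pairs \<and> \<phi> e"
  using assms by (auto simp: germ_pairs_def spec_D_def sinv_mult_restrict char_mult_iff)

text \<open>A germ determines its character, so the slice of \<open>s\<close> contains at most one
  germ at \<open>\<phi>\<close>, namely that of \<open>s\<close>.\<close>

lemma Theta_germ:
  assumes "(t, \<phi>) \<in> germ_pairs"
  shows "Theta s (germ t \<phi>) = (if (s, \<phi>) \<in> germ_pairs \<and> germ t \<phi> = germ s \<phi> then 1 else 0)"
proof -
  have "germ t \<phi> \<in> germ_slice s (spec_D (sinv s * s)) \<longleftrightarrow>
      (s, \<phi>) \<in> germ_pairs \<and> germ t \<phi> = germ s \<phi>"
    using germ_eq_imp_char_eq[OF _ assms, of s]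
    by (auto simp: germ_slice_def germ_pairs_def) 
  then show ?thesis by (simp add: Theta_def char_fun_def)
qed

lemma Theta_outside: "x \<notin> germs \<Longrightarrow> Theta s x = 0"
  using germ_in_germs[of s] by (auto simp: Theta_def char_fun_def germ_slice_def germ_pairs_def)

section \<open>The linear extension of \<open>Theta\<close>\<close>

definition lin_Theta ::
  "('s::inverse_semigroup \<Rightarrow>\<^sub>0 'k::{comm_ring, comm_monoid_mult}) \<Rightarrow> 's germ \<Rightarrow> 'k" where
  "lin_Theta p x = (\<Sum>s\<in>Poly_Mapping.keys p. Poly_Mapping.lookup p s * Theta s x)"

text \<open>A common finite index set lets sums over different supports be compared.\<close>

lemma lin_Theta_superset:
  assumes "finite A" "Poly_Mapping.keys p \<subseteq> A"
  shows "lin_Theta p x = (\<Sum>s\<in>A. Poly_Mapping.lookup p s * Theta s x)"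
  unfolding lin_Theta_def using assms
  by (intro sum.mono_neutral_left) (auto simp: in_keys_iff)

lemma lin_Theta_outside: "x \<notin> germs \<Longrightarrow> lin_Theta p x = 0"
  by (simp add: lin_Theta_def Theta_outside)

lemma lin_Theta_single: "lin_Theta (Poly_Mapping.single s c) x = c * Theta s x"
  by (subst lin_Theta_superset[of "{s}"]) auto

lemma lin_Theta_zero: "lin_Theta 0 x = 0"
  by (simp add: lin_Theta_def)

lemma lin_Theta_add: "lin_Theta (p + q) x = lin_Theta p x + lin_Theta q x"
proof -
  define A where "A = Poly_Mapping.keys p \<union> Poly_Mapping.keys q"
  have "finite A" by (simp add: A_def)
  then show ?thesis
    using keys_add[of p q]
    by (simp add: lin_Theta_superset[of A] A_def lookup_add distrib_right sum.distrib)
qed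

lemma lin_Theta_sum: "lin_Theta (\<Sum>i\<in>I. p i) x = (\<Sum>i\<in>I. lin_Theta (p i) x)"
  by (induction I rule: infinite_finite_induct) (auto simp: lin_Theta_zero lin_Theta_add)

lemma lookup_sa_scale: "Poly_Mapping.lookup (sa_scale c p) s = c * Poly_Mapping.lookup p s"
  by (simp add: sa_scale_def Poly_Mapping.map.rep_eq when_def)

lemma lin_Theta_scale: "lin_Theta (sa_scale c p) x = c * lin_Theta p x"
proof -
  have "Poly_Mapping.keys (sa_scale c p) \<subseteq> Poly_Mapping.keys p"
    by (auto simp: in_keys_iff lookup_sa_scale)
  then show ?thesis
    by (simp add: lin_Theta_superset[of "Poly_Mapping.keys p"] lookup_sa_scale
        sum_distrib_left mult.assoc)
qed

section \<open>Convolution and the product of the semigroup algebra\<close>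

text \<open>The index set in \<open>convolution\<close> depends on both factors. Any finite part of
  the fibre outside which the right factor vanishes may replace it, so that convolutions with
  different factors become sums over the same set.\<close>

lemma convolution_eq_sum:
  assumes "x \<in> arrows G" "finite Y" "Y \<subseteq> {y \<in> arrows G. gdom G y = gdom G x}"
    "\<And>y. \<lbrakk>y \<in> arrows G; gdom G y = gdom G x; y \<notin> Y\<rbrakk> \<Longrightarrow> g y = 0"
  shows "convolution G f g x = (\<Sum>y\<in>Y. f (gmult G x (ginv G y)) * g y)"
proof -
  have "(\<Sum>y\<in>{y \<in> arrows G. gdom G y = gdom G x \<and> f (gmult G x (ginv G y)) * g y \<noteq> 0}.
      f (gmult G x (ginv G y)) * g y) = (\<Sum>y\<in>Y. f (gmult G x (ginv G y)) * g y)"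
    using assms by (intro sum.mono_neutral_left) force+
  then show ?thesis using assms by (simp add: convolution_def)
qed

lemma fibre_germ:
  assumes "(u, \<phi>) \<in> germ_pairs" "y \<in> germs"
    "gdom universal_groupoid y = gdom universal_groupoid (germ u \<phi>)"
  obtains t where "(t, \<phi>) \<in> germ_pairs" "y = germ t \<phi>"
  using assms gdom_germ_eq_iff germs_cases by metis

text \<open>In the fibre over \<open>\<phi>\<close>, the function \<open>Theta t\<close> can be
  non-zero only at the germ of \<open>t\<close>, so the sum has at most one term.\<close>

lemma convolution_Theta_right:
  assumes "(u, \<phi>) \<in> germ_pairs"
  shows "convolution universal_groupoid f (Theta t) (germ u \<phi>) =
    (if (t, \<phi>) \<in> germ_pairs then f (germ_mult (germ u \<phi>) (germ_inv (germ t \<phi>))) else 0)"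
proof -
  define Y where "Y = (if (t, \<phi>) \<in> germ_pairs then {germ t \<phi>} else {})"
  have "convolution universal_groupoid f (Theta t) (germ u \<phi>) =
    (\<Sum>y\<in>Y. f (gmult universal_groupoid (germ u \<phi>) (ginv universal_groupoid y)) * Theta t y)"
  proof (rule convolution_eq_sum)
    fix y assume y: "y \<in> arrows universal_groupoid"
      "gdom universal_groupoid y = gdom universal_groupoid (germ u \<phi>)" "y \<notin> Y"
    then obtain v where "(v, \<phi>) \<in> germ_pairs" "y = germ v \<phi>"
      using fibre_germ[OF assms] arrows_universal_groupoid by metis
    then show "Theta t y = 0" using y by (auto simp: Theta_germ Y_def split: if_splits)
  qed (use assms gdom_germ_eq_iff[of t \<phi> u \<phi>] in
      \<open>auto simp: Y_def arrows_universal_groupoid germ_in_germs split: if_splits\<close>)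
  then show ?thesis
    by (auto simp: Y_def Theta_germ universal_groupoid_def)
qed

lemma convolution_lin_Theta_right:
  assumes "(u, \<phi>) \<in> germ_pairs"
  shows "convolution universal_groupoid f (lin_Theta q) (germ u \<phi>) =
    (\<Sum>t\<in>Poly_Mapping.keys q. Poly_Mapping.lookup q t *
       convolution universal_groupoid f (Theta t) (germ u \<phi>))"
proof -
  define x where "x = germ u \<phi>"
  \<comment> \<open>One finite set for all \<open>t\<close> at once: within the fibre,
    \<open>Theta t\<close> vanishes outside it for every \<open>t\<close> in the support of
    \<open>q\<close>, so the two sums can be interchanged.\<close>
  define Y where "Y = (\<lambda>t. germ t \<phi>) ` {t \<in> Poly_Mapping.keys q. (t, \<phi>) \<in> germ_pairs}"
  have x: "x \<in> arrows universal_groupoid"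
    using assms by (simp add: x_def arrows_universal_groupoid germ_in_germs)
  have "germ t \<phi> \<in> arrows universal_groupoid"
    "gdom universal_groupoid (germ t \<phi>) = gdom universal_groupoid x" if "(t, \<phi>) \<in> germ_pairs" for t
    using that gdom_germ_eq_iff[OF that assms]
    by (simp_all add: x_def arrows_universal_groupoid germ_in_germs)
  then have Y: "finite Y"
    "Y \<subseteq> {y \<in> arrows universal_groupoid. gdom universal_groupoid y = gdom universal_groupoid x}"
    unfolding Y_def by (simp, blast)
  have 0: "Theta t y = 0" if y: "y \<in> arrows universal_groupoid"
    "gdom universal_groupoid y = gdom universal_groupoid x" "y \<notin> Y" "t \<in> Poly_Mapping.keys q" for t y
  proof -
    obtain v where "(v, \<phi>) \<in> germ_pairs" "y = germ v \<phi>"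
      using fibre_germ[OF assms y(1,2)[unfolded arrows_universal_groupoid x_def]] .
    then show ?thesis using y by (auto simp: Theta_germ Y_def)
  qed
  let ?f = "\<lambda>y. f (gmult universal_groupoid x (ginv universal_groupoid y))"
  have "convolution universal_groupoid f (lin_Theta q) x = (\<Sum>y\<in>Y. ?f y * lin_Theta q y)"
    by (rule convolution_eq_sum[OF x Y]) (simp add: lin_Theta_def 0)
  also have "\<dots> = (\<Sum>t\<in>Poly_Mapping.keys q. Poly_Mapping.lookup q t * (\<Sum>y\<in>Y. ?f y * Theta t y))"
    unfolding lin_Theta_def sum_distrib_left
    by (subst sum.swap) (simp add: mult.left_commute)
  also have "\<dots> = (\<Sum>t\<in>Poly_Mapping.keys q. Poly_Mapping.lookup q t *
       convolution universal_groupoid f (Theta t) x)"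
    by (intro sum.cong refl) (simp add: convolution_eq_sum[OF x Y 0])
  finally show ?thesis by (simp add: x_def)
qed

lemma germ_pairs_sinv:
  "(s, \<phi>) \<in> germ_pairs \<Longrightarrow> (sinv s, spec_act s \<phi>) \<in> germ_pairs"
  using spec_act_mem[of s \<phi>] by (simp add: germ_pairs_def)

lemma spec_act_mult:
  "spec_act s (spec_act t \<phi>) = spec_act (s * t) \<phi>"
  by (simp add: spec_act_def restrict_def fun_eq_iff sinv_mult) (simp add: mult.assoc)

lemma spec_act_idem:
  assumes "(e, \<phi>) \<in> germ_pairs" "e \<in> idempotents"
  shows "spec_act e \<phi> = \<phi>"
proof
  fix f
  have \<phi>: "\<phi> \<in> spectrum" "\<phi> e"
    using assms by (auto simp: germ_pairs_def spec_D_def)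
  show "spec_act e \<phi> f = \<phi> f"
  proof (cases "f \<in> idempotents")
    case True
    then have "\<phi> (e * f * e) = \<phi> f"
      using \<phi> assms by (simp add: char_mult_iff)
    then show ?thesis using True assms by (simp add: spec_act_def sinv_idem)
  next
    case False
    \<comment> \<open>Off the idempotents both functions take the value \<open>undefined\<close>, as
      characters are extensional.\<close>
    then show ?thesis using \<phi> by (simp add: spec_act_def spectrum_def extensional_def)
  qed
qed

lemma spec_act_sinv:
  assumes "(s, \<phi>) \<in> germ_pairs"
  shows "spec_act (sinv s) (spec_act s \<phi>) = \<phi>"
proof -
  have "(sinv s * s, \<phi>) \<in> germ_pairs"
    using assms by (simp add: germ_pairs_def)
  then show ?thesis by (simp add: spec_act_mult spec_act_idem)
qed

text \<open>The element \<open>u * sinv t * t\<close> is \<open>u\<close> restricted by the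
  idempotent \<open>sinv t * t\<close>, which holds at \<open>\<phi>\<close>.\<close>

lemma germ_mult_sinv_cancel:
  assumes "(u, \<phi>) \<in> germ_pairs" "(t, \<phi>) \<in> germ_pairs"
  shows "germ (u * sinv t * t) \<phi> = germ u \<phi>" "(u * sinv t * t, \<phi>) \<in> germ_pairs"
proof -
  have "\<phi> (sinv t * t)" using assms by (simp add: germ_pairs_def spec_D_def)
  then show *: "(u * sinv t * t, \<phi>) \<in> germ_pairs"
    using germ_pairs_mult_idem_iff[of "sinv t * t" u \<phi>] assms by (simp add: mult.assoc)
  show "germ (u * sinv t * t) \<phi> = germ u \<phi>"
    using germ_nat_le(2)[OF _ *, of u] nat_le_mult_idem[of "sinv t * t" u] by (simp add: mult.assoc)
qed

text \<open>Where \<open>t\<close> is defined at \<open>\<phi>\<close>, the single term compares the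
  germs of \<open>u * sinv t\<close> and \<open>s\<close> at \<open>spec_act t \<phi>\<close>.
  Multiplication on the right by the germ of \<open>t\<close>, or by its inverse, translates between
  this and a comparison of \<open>u\<close> with \<open>s * t\<close> at
  \<open>\<phi>\<close>.\<close>

lemma convolution_Theta_Theta:
  "convolution universal_groupoid (Theta s) (Theta t) x = Theta (s * t) x"
proof (cases "x \<in> germs")
  case False
  then show ?thesis by (simp add: convolution_def arrows_universal_groupoid Theta_outside)
next
  case True
  then obtain u \<phi> where u: "(u, \<phi>) \<in> germ_pairs" "x = germ u \<phi>" by (rule germs_cases)
  show ?thesis
  proof (cases "(t, \<phi>) \<in> germ_pairs")
    case False
    \<comment> \<open>The domain of \<open>s * t\<close> lies inside that of \<open>t\<close>, so
      both sides vanish here.\<close>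
    have "(s * t, \<phi>) \<notin> germ_pairs"
    proof
      assume st: "(s * t, \<phi>) \<in> germ_pairs"
      have "s * t * (sinv t * t) = s * t" by (simp add: mult.assoc sinv_props')
      then have "\<phi> (sinv t * t)"
        using st germ_pairs_mult_idem_iff[OF idem_sinv_mult(1)[of t], of "s * t" \<phi>] by metis
      then show False using st False by (simp add: germ_pairs_def spec_D_def)
    qed
    then show ?thesis using u False by (simp add: convolution_Theta_right Theta_germ)
  next
    case t: True
    define \<psi> where "\<psi> = spec_act t \<phi>"
    have t': "(sinv t, \<psi>) \<in> germ_pairs" "spec_act (sinv t) \<psi> = \<phi>"
      using t germ_pairs_sinv spec_act_sinv by (auto simp: \<psi>_def)
    have ut: "(u * sinv t, \<psi>) \<in> germ_pairs"
      by (rule germ_pairs_mult) (simp_all only: t' u)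
    have eq: "germ_mult (germ u \<phi>) (germ_inv (germ t \<phi>)) = germ (u * sinv t) \<psi>"
      unfolding germ_inv_germ[OF t] \<psi>_def[symmetric]
      by (rule germ_mult_germ[OF u(1) t'])
    have "(s, \<psi>) \<in> germ_pairs \<and> germ (u * sinv t) \<psi> = germ s \<psi> \<longleftrightarrow>
       (s * t, \<phi>) \<in> germ_pairs \<and> germ u \<phi> = germ (s * t) \<phi>" (is "?l \<longleftrightarrow> ?r")
    proof
      assume l: ?l
      have "germ u \<phi> = germ_mult (germ (u * sinv t) \<psi>) (germ t \<phi>)"
        unfolding germ_mult_germ[OF ut t \<psi>_def[symmetric]] germ_mult_sinv_cancel(1)[OF u(1) t] ..
      also have "\<dots> = germ (s * t) \<phi>"
        using germ_mult_germ[OF conjunct1[OF l] t \<psi>_def[symmetric]] l by metis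
      finally show ?r using germ_pairs_mult[OF _ t] l unfolding \<psi>_def by blast
    next
      assume r: ?r
      have s: "(s, \<psi>) \<in> germ_pairs"
      proof -
        have "spec_act t \<phi> (sinv s * s)"
          using r by (simp add: spec_act_def germ_pairs_def spec_D_def sinv_mult mult.assoc)
        moreover have "\<psi> \<in> spectrum" using t' by (auto simp: germ_pairs_def spec_D_def)
        ultimately show ?thesis by (simp add: \<psi>_def germ_pairs_def spec_D_def)
      qed
      have "germ (u * sinv t) \<psi> = germ_mult (germ u \<phi>) (germ (sinv t) \<psi>)"
        using germ_mult_germ[OF u(1) t'] by simp
      also have "\<dots> = germ (s * t * sinv t) \<psi>"
        using r germ_mult_germ[OF _ t'] by simp
      also have "\<dots> = germ s \<psi>"
        using germ_mult_sinv_cancel[OF s t'(1)] by simp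
      finally show ?l using s by simp
    qed
    then show ?thesis
      using u t ut by (simp add: convolution_Theta_right eq Theta_germ)
  qed
qed

lemma convolution_lin_Theta:
  "convolution universal_groupoid (lin_Theta p) (lin_Theta q) x = lin_Theta (sa_mult p q) x"
proof (cases "x \<in> germs")
  case False
  then show ?thesis by (simp add: convolution_def arrows_universal_groupoid lin_Theta_outside)
next
  case True
  then obtain u \<phi> where u: "(u, \<phi>) \<in> germ_pairs" "x = germ u \<phi>" by (rule germs_cases)
  \<comment> \<open>Against a single \<open>Theta t\<close> the convolution is either zero or one
    evaluation of the left factor, so linearity on the left is immediate.\<close>
  have left: "convolution universal_groupoid (lin_Theta p) (Theta t) x =
      (\<Sum>s\<in>Poly_Mapping.keys p. Poly_Mapping.lookup p s * Theta (s * t) x)" for t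
    unfolding convolution_Theta_Theta[symmetric] u(2) convolution_Theta_right[OF u(1)]
    by (simp add: lin_Theta_def)
  show ?thesis
    unfolding sa_mult_def lin_Theta_sum lin_Theta_single
    unfolding u(2) convolution_lin_Theta_right[OF u(1)] left[unfolded u(2)]
    by (subst sum.swap) (simp add: sum_distrib_left ac_simps)
qed

section \<open>Compatibility with the involution\<close>

text \<open>A common lower bound \<open>v\<close> of \<open>s\<close> and \<open>sinv u\<close>
  gives the common lower bound \<open>sinv v\<close> of \<open>sinv s\<close> and \<open>u\<close>,
  so inversion carries the slice of \<open>s\<close> to that of \<open>sinv s\<close>.\<close>

lemma Theta_germ_inv:
  assumes "(u, \<phi>) \<in> germ_pairs"
  shows "Theta s (germ_inv (germ u \<phi>)) = Theta (sinv s) (germ u \<phi>)"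
proof -
  \<comment> \<open>General in \<open>u\<close>, \<open>s\<close> and \<open>\<phi>\<close>, because
    the converse is the same implication at the inverse germ.\<close>
  have *: "(s, spec_act u \<phi>) \<in> germ_pairs \<and> germ (sinv u) (spec_act u \<phi>) = germ s (spec_act u \<phi>)
    \<Longrightarrow> (sinv s, \<phi>) \<in> germ_pairs \<and> germ u \<phi> = germ (sinv s) \<phi>"
    if u: "(u, \<phi>) \<in> germ_pairs" for u s :: 'a and \<phi>
  proof -
    assume a: "(s, spec_act u \<phi>) \<in> germ_pairs \<and> germ (sinv u) (spec_act u \<phi>) = germ s (spec_act u \<phi>)"
    then obtain v where v: "nat_le v s" "nat_le v (sinv u)" "(v, spec_act u \<phi>) \<in> germ_pairs"
      using germ_eq_iff_nat_le[OF germ_pairs_sinv[OF u]] by blast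
    have "spec_act v (spec_act u \<phi>) = \<phi>"
      using spec_act_nat_le[OF v(2)] v(3) spec_act_sinv[OF u] by (simp add: germ_pairs_def)
    then have p: "(sinv v, \<phi>) \<in> germ_pairs" using germ_pairs_sinv[OF v(3)] by simp
    have le: "nat_le (sinv v) (sinv s)" "nat_le (sinv v) u"
      using nat_le_sinv[OF v(1)] nat_le_sinv[OF v(2)] by simp_all
    show ?thesis
      using germ_nat_le(1)[OF le(1) p] germ_nat_le(2)[OF le(1) p] germ_nat_le(2)[OF le(2) p] by simp
  qed
  have "(s, spec_act u \<phi>) \<in> germ_pairs \<and> germ (sinv u) (spec_act u \<phi>) = germ s (spec_act u \<phi>)
    \<longleftrightarrow> (sinv s, \<phi>) \<in> germ_pairs \<and> germ u \<phi> = germ (sinv s) \<phi>"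
    using *[OF assms, of s]
      *[OF germ_pairs_sinv[OF assms], of "sinv s", unfolded sinv_sinv spec_act_sinv[OF assms]]
    by blast
  then show ?thesis
    using germ_pairs_sinv[OF assms] assms by (simp add: germ_inv_germ Theta_germ)
qed

lemma lin_Theta_star:
  "lin_Theta (sa_star p) = ga_star universal_groupoid (lin_Theta p)"
proof
  fix x
  show "lin_Theta (sa_star p) x = ga_star universal_groupoid (lin_Theta p) x"
  proof (cases "x \<in> germs")
    case False
    then show ?thesis by (simp add: ga_star_def arrows_universal_groupoid lin_Theta_outside)
  next
    case True
    then obtain u \<phi> where u: "(u, \<phi>) \<in> germ_pairs" "x = germ u \<phi>" by (rule germs_cases)
    \<comment> \<open>Conjugation fixes 0 and 1, the only values of \<open>Theta\<close>.\<close>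
    have "cnj (Theta s (germ_inv x)) = Theta (sinv s) x" for s
      unfolding u(2) Theta_germ_inv[OF u(1)] by (simp add: Theta_germ[OF u(1)])
    then show ?thesis
      using True unfolding sa_star_def lin_Theta_sum lin_Theta_single
      by (simp add: ga_star_def arrows_universal_groupoid lin_Theta_def[of p])
        (simp add: universal_groupoid_def)
  qed
qed

subsection \<open>Injectivity\<close>

text \<open>A restriction of \<open>s\<close> is recovered from its domain: if
  \<open>u = e * s\<close>, then \<open>sinv u * u = sinv s * e * s\<close>, and \<open>e\<close>
  commutes with \<open>s * sinv s\<close>.\<close>

lemma nat_le_eq_mult:
  assumes "nat_le u s"
  shows "s * (sinv u * u) = u"
proof -
  obtain e where e: "e \<in> idempotents" "u = e * s"
    using assms by (auto simp: nat_le_def)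
  have "sinv u * u = sinv s * (e * e) * s"
    using e by (simp add: sinv_mult sinv_idem mult.assoc)
  also have "\<dots> = sinv s * e * s"
    using e by (simp add: idempotents_def)
  finally have "s * (sinv u * u) = (s * sinv s * e) * s"
    by (simp add: mult.assoc)
  also have "\<dots> = e * (s * sinv s * s)"
    unfolding idem_commute[OF idem_sinv_mult(2) e(1)] by (simp only: mult.assoc)
  finally show ?thesis using e by (simp add: sinv_props)
qed

lemma nat_le_trans:
  assumes "nat_le s t" "nat_le t u"
  shows "nat_le s u"
proof -
  obtain e f where ef: "e \<in> idempotents" "f \<in> idempotents" "s = e * t" "t = f * u"
    using assms by (auto simp: nat_le_def)
  then have "s = (e * f) * u" by (simp add: mult.assoc)
  then show ?thesis using ef idem_mult unfolding nat_le_def by blast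
qed

text \<open>From \<open>s = e * t\<close> follows \<open>e * s = s\<close>; then
  \<open>t = f * s = f * e * s = e * f * s = e * t = s\<close>.\<close>

lemma nat_le_antisym:
  assumes "nat_le s t" "nat_le t s"
  shows "s = t"
proof -
  obtain e f where ef: "e \<in> idempotents" "s = e * t" "f \<in> idempotents" "t = f * s"
    using assms by (auto simp: nat_le_def)
  have "e * s = (e * e) * t" by (simp add: ef(2) mult.assoc)
  also have "\<dots> = s" using ef(1,2) by (simp add: idempotents_def)
  finally have es: "e * s = s" .
  have "t = (f * e) * s" unfolding mult.assoc es by (rule ef(4))
  also have "\<dots> = e * (f * s)" unfolding idem_commute[OF ef(3,1)] by (rule mult.assoc)
  also have "\<dots> = s" unfolding ef(4)[symmetric] by (rule ef(2)[symmetric])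
  finally show ?thesis ..
qed

text \<open>The indicator of the principal filter of \<open>e\<close>: for idempotents,
  \<open>e * f = e\<close> means that \<open>f\<close> lies above \<open>e\<close>.\<close>

definition principal_char :: "'s::inverse_semigroup \<Rightarrow> 's \<Rightarrow> bool" where
  "principal_char e = (\<lambda>f\<in>idempotents. e * f = e)"

lemma principal_char_in_spec_D:
  assumes "e \<in> idempotents"
  shows "principal_char e \<in> spec_D e"
proof -
  have "e * (f * g) = e \<longleftrightarrow> e * f = e \<and> e * g = e"
    if f: "f \<in> idempotents" and g: "g \<in> idempotents" for f g
  proof
    assume *: "e * (f * g) = e"
    have "e * f = e * (f * (g * f))" using * by (simp add: mult.assoc[symmetric])
    also have "\<dots> = e * ((f * f) * g)" unfolding idem_commute[OF g f] by (simp add: mult.assoc)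
    also have "\<dots> = e" using * f by (simp add: idempotents_def)
    finally have "e * f = e" .
    moreover have "e * g = e" using calculation * by (simp add: mult.assoc[symmetric])
    ultimately show "e * f = e \<and> e * g = e" ..
  qed (simp add: mult.assoc[symmetric])
  then show ?thesis
    using assms by (auto simp: spec_D_def spectrum_def principal_char_def) (auto simp: idempotents_def)
qed

text \<open>No proper restriction of \<open>s\<close> is defined at this character: if
  \<open>u\<close> lies below \<open>s\<close> and \<open>sinv u * u\<close> lies above
  \<open>sinv s * s\<close>, then \<open>u = s * (sinv u * u) = s\<close>. Hence equal germs of
  \<open>s\<close> and \<open>t\<close> force \<open>s\<close> itself below
  \<open>t\<close>.\<close>

lemma Theta_germ_principal_char:
  "Theta t (germ s (principal_char (sinv s * s))) = (if nat_le s t then 1 else 0)"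
proof -
  define \<phi> where "\<phi> = principal_char (sinv s * s)"
  have s: "(s, \<phi>) \<in> germ_pairs"
    using principal_char_in_spec_D[OF idem_sinv_mult(1)[of s]] by (simp add: germ_pairs_def \<phi>_def)
  have "(t, \<phi>) \<in> germ_pairs \<and> germ s \<phi> = germ t \<phi> \<longleftrightarrow> nat_le s t"
  proof
    assume "(t, \<phi>) \<in> germ_pairs \<and> germ s \<phi> = germ t \<phi>"
    then obtain u where u: "nat_le u s" "nat_le u t" "(u, \<phi>) \<in> germ_pairs"
      using germ_eq_iff_nat_le[OF s] by blast
    have "sinv s * s * (sinv u * u) = sinv s * s"
      using u(3) by (simp add: germ_pairs_def spec_D_def \<phi>_def principal_char_def)
    then have "s * (sinv s * s * (sinv u * u)) = s * (sinv s * s)" by simp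
    then have "s * (sinv u * u) = s"
      by (simp add: mult.assoc sinv_props' sinv_props'')
    then show "nat_le s t" using u(2) nat_le_eq_mult[OF u(1)] by simp
  next
    assume "nat_le s t"
    then show "(t, \<phi>) \<in> germ_pairs \<and> germ s \<phi> = germ t \<phi>"
      using germ_nat_le[of s t \<phi>] s by simp
  qed
  then show ?thesis unfolding \<phi>_def[symmetric] Theta_germ[OF s] by simp
qed

lemma lin_Theta_eq_zero:
  assumes "\<And>x. lin_Theta p x = 0"
  shows "p = 0"
proof (rule ccontr)
  assume "p \<noteq> 0"
  \<comment> \<open>The strict order, because the existence of a maximal element of a finite set is
    taken from a fact about asymmetric relations.\<close>
  define R where "R s t \<longleftrightarrow> nat_le s t \<and> s \<noteq> t" for s t :: 'a
  have "\<exists>m\<in>Poly_Mapping.keys p. \<forall>t\<in>Poly_Mapping.keys p. t \<noteq> m \<longrightarrow> \<not> R m t"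
  proof (rule Finite_Set.bex_max_element)
    show "asymp_on (Poly_Mapping.keys p) R"
      by (auto simp: asymp_on_def R_def dest: nat_le_antisym)
    show "transp_on (Poly_Mapping.keys p) R"
      unfolding transp_on_def R_def by (blast intro: nat_le_trans dest: nat_le_antisym)
    show "Poly_Mapping.keys p \<noteq> {}" using \<open>p \<noteq> 0\<close> by simp
  qed simp
  then obtain m where "m \<in> Poly_Mapping.keys p"
    "\<forall>t\<in>Poly_Mapping.keys p. t \<noteq> m \<longrightarrow> \<not> R m t" by blast
  then have m: "m \<in> Poly_Mapping.keys p"
    "\<And>t. t \<in> Poly_Mapping.keys p \<Longrightarrow> nat_le m t \<longleftrightarrow> t = m"
    by (auto simp: R_def)
  have "lin_Theta p (germ m (principal_char (sinv m * m))) =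
      (\<Sum>t\<in>Poly_Mapping.keys p. if t = m then Poly_Mapping.lookup p t else 0)"
    unfolding lin_Theta_def Theta_germ_principal_char by (rule sum.cong) (auto simp: m(2))
  also have "\<dots> = Poly_Mapping.lookup p m" using m(1) by simp
  finally show False using assms m(1) by (simp add: in_keys_iff)
qed

lemma lin_Theta_diff: "lin_Theta (p - q) x = lin_Theta p x - lin_Theta q x"
  using lin_Theta_add[of "p - q" q x] by (simp add: eq_diff_eq)

lemma inj_lin_Theta: "inj lin_Theta"
proof (rule injI)
  fix p q :: "'a \<Rightarrow>\<^sub>0 'b"
  assume "lin_Theta p = lin_Theta q"
  then have "p - q = 0" by (intro lin_Theta_eq_zero) (simp add: lin_Theta_diff)
  then show "p = q" by simp
qed

subsection \<open>Topology of the universal groupoid\<close>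

lemma closedin_spectrum_eval:
  assumes "e \<in> idempotents"
  shows "closedin (product_topology (\<lambda>_. discrete_topology (UNIV :: bool set)) idempotents)
    {\<phi> \<in> extensional idempotents. \<phi> e = b}"
proof -
  have "closedin (product_topology (\<lambda>_. discrete_topology (UNIV :: bool set)) idempotents)
    {\<phi> \<in> topspace (product_topology (\<lambda>_. discrete_topology (UNIV :: bool set)) idempotents). \<phi> e \<in> {b}}"
    by (rule closedin_continuous_map_preimage[OF continuous_map_product_projection[OF assms]]) simp
  then show ?thesis by (simp add: PiE_def)
qed

text \<open>The set is closed in the compact space of all functions from the idempotents to
  \<open>bool\<close>. The condition \<open>\<phi> e\<close> implies that \<open>\<phi>\<close> is
  non-zero, which in general is not a closed condition by itself.\<close>

lemma compactin_spec_D: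
  assumes e: "e \<in> idempotents"
  shows "compactin spectrum_top (spec_D e)"
proof -
  let ?P = "product_topology (\<lambda>_. discrete_topology (UNIV :: bool set)) (idempotents :: 'a set)"
  let ?V = "\<lambda>e b. {\<phi> \<in> extensional (idempotents :: 'a set). \<phi> e = b}"
  \<comment> \<open>Multiplicativity at \<open>f\<close> and \<open>g\<close>, written with sets
    that fix one coordinate each, so that it is visibly closed.\<close>
  define C where "C f g = (?V (f * g) True \<inter> ?V f True \<inter> ?V g True) \<union>
    (?V (f * g) False \<inter> (?V f False \<union> ?V g False))" for f g :: 'a
  have "closedin ?P (\<Inter>(insert (?V e True) ((\<lambda>(f, g). C f g) ` (idempotents \<times> idempotents))))"
    unfolding C_def using e
    by (intro closedin_Inter) (auto intro!: closedin_Int closedin_Un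
        closedin_spectrum_eval[where b = True, simplified] closedin_spectrum_eval[where b = False, simplified])
  also have "\<Inter>(insert (?V e True) ((\<lambda>(f, g). C f g) ` (idempotents \<times> idempotents))) = spec_D e"
    using e by (auto simp: C_def spec_D_def spectrum_def)
  finally have "closedin ?P (spec_D e)" .
  moreover have "compact_space ?P"
    by (simp add: compact_space_product_topology compact_space_discrete_topology)
  ultimately have "compactin ?P (spec_D e)" by (rule closedin_compact_space[rotated])
  then show ?thesis
    by (simp add: spectrum_top_def compactin_subtopology) (auto simp: spec_D_def)
qed

lemma Hausdorff_spectrum_top: "Hausdorff_space spectrum_top"
  unfolding spectrum_top_def
  by (simp add: Hausdorff_space_subtopology Hausdorff_space_product_topology)

lemma closedin_spec_D: "e \<in> idempotents \<Longrightarrow> closedin spectrum_top (spec_D e)"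
  by (intro compactin_imp_closedin Hausdorff_spectrum_top compactin_spec_D)

lemma openin_germ_slice:
  assumes "openin spectrum_top U" "U \<subseteq> spec_D (sinv s * s)"
  shows "openin (gtop universal_groupoid) (germ_slice s U)"
  unfolding openin_universal_groupoid using assms by (auto simp: germ_basis_def)

text \<open>Continuity of \<open>germ s\<close>: if the germ of \<open>s\<close> at
  \<open>\<phi>\<close> lies in a slice of \<open>t\<close>, then some \<open>u\<close> below both
  is defined at \<open>\<phi>\<close>, and the germs of \<open>s\<close> and \<open>t\<close> agree
  on all of \<open>spec_D (sinv u * u)\<close>.\<close>

lemma openin_germ_preimage:
  assumes "openin (gtop universal_groupoid) X"
  shows "openin spectrum_top {\<phi> \<in> spec_D (sinv s * s). germ s \<phi> \<in> X}"
  unfolding openin_subopen[of _ "{\<phi> \<in> spec_D (sinv s * s). germ s \<phi> \<in> X}"]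
proof
  fix \<phi> assume \<phi>: "\<phi> \<in> {\<phi> \<in> spec_D (sinv s * s). germ s \<phi> \<in> X}"
  then have s: "(s, \<phi>) \<in> germ_pairs" by (simp add: germ_pairs_def)
  obtain t U where U: "openin spectrum_top U" "U \<subseteq> spec_D (sinv t * t)"
      "germ s \<phi> \<in> germ_slice t U" "germ_slice t U \<subseteq> X"
    using \<phi> assms unfolding openin_universal_groupoid germ_basis_def by blast
  have "\<phi> \<in> U" "((t, \<phi>), (s, \<phi>)) \<in> germ_rel"
    using germ_in_slice_iff[OF U(2) s] U(3) by auto
  then obtain u where u: "nat_le u t" "nat_le u s" "\<phi> \<in> spec_D (sinv u * u)"
    by (auto simp: germ_rel_def)
  have "germ s \<psi> \<in> X \<and> \<psi> \<in> spec_D (sinv s * s)" if \<psi>: "\<psi> \<in> U \<inter> spec_D (sinv u * u)" for \<psi>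
  proof -
    have "(u, \<psi>) \<in> germ_pairs" using \<psi> by (simp add: germ_pairs_def)
    from germ_nat_le[OF u(1) this] germ_nat_le[OF u(2) this]
    have "germ s \<psi> = germ t \<psi>" "(s, \<psi>) \<in> germ_pairs" by simp_all
    then show ?thesis using U(4) \<psi> by (auto simp: germ_slice_def germ_pairs_def)
  qed
  then show "\<exists>T. openin spectrum_top T \<and> \<phi> \<in> T \<and> T \<subseteq> {\<phi> \<in> spec_D (sinv s * s). germ s \<phi> \<in> X}"
    using \<open>\<phi> \<in> U\<close> u(3) U(1)
    by (intro exI[of _ "U \<inter> spec_D (sinv u * u)"]) (auto intro!: openin_Int openin_spec_D)
qed

lemma topspace_universal_groupoid: "topspace (gtop universal_groupoid) = germs"
  using arrows_universal_groupoid by (simp add: arrows_def)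

text \<open>This transports compactness and the Hausdorff property from the spectrum to single
  slices; the whole groupoid may fail to be Hausdorff. Openness holds because images of open sets
  are basic slices.\<close>

lemma homeomorphic_map_germ:
  "homeomorphic_map (subtopology spectrum_top (spec_D (sinv s * s)))
     (subtopology (gtop universal_groupoid) (germ_slice s (spec_D (sinv s * s)))) (germ s)"
proof (rule bijective_open_imp_homeomorphic_map)
  let ?D = "spec_D (sinv s * s)"
  have D: "openin spectrum_top ?D" "?D \<subseteq> spectrum" by (simp_all add: openin_spec_D) (simp add: spec_D_def)
  have A: "openin (gtop universal_groupoid) (germ_slice s ?D)"
    by (simp add: openin_germ_slice openin_spec_D)
  have top: "topspace (subtopology spectrum_top ?D) = ?D"
    using D(2) by (auto simp: topspace_spectrum_top)
  have topA: "topspace (subtopology (gtop universal_groupoid) (germ_slice s ?D)) = germ_slice s ?D"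
    using A openin_subset by fastforce
  show "continuous_map (subtopology spectrum_top ?D)
     (subtopology (gtop universal_groupoid) (germ_slice s ?D)) (germ s)"
    unfolding continuous_map_openin_preimage_eq top topA openin_open_subtopology[OF A]
      openin_open_subtopology[OF D(1)]
    using openin_germ_preimage[of _ s] by (auto simp: germ_slice_def vimage_def Int_def)
  show "open_map (subtopology spectrum_top ?D)
     (subtopology (gtop universal_groupoid) (germ_slice s ?D)) (germ s)"
    unfolding open_map_def openin_open_subtopology[OF A] openin_open_subtopology[OF D(1)]
    using openin_germ_slice[of _ s] by (auto simp: germ_slice_def)
  show "germ s ` topspace (subtopology spectrum_top ?D) =
      topspace (subtopology (gtop universal_groupoid) (germ_slice s ?D))"
    unfolding top topA by (simp only: germ_slice_def)
  show "inj_on (germ s) (topspace (subtopology spectrum_top ?D))"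
    unfolding top by (auto intro!: inj_onI germ_eq_imp_char_eq[of s _ s] simp: germ_pairs_def)
qed

lemma compactin_germ_image_iff:
  assumes "W \<subseteq> spec_D (sinv s * s)"
  shows "compactin (gtop universal_groupoid) (germ s ` W) \<longleftrightarrow> compactin spectrum_top W"
proof -
  have "germ s ` W \<subseteq> germ_slice s (spec_D (sinv s * s))" using assms by (auto simp: germ_slice_def)
  moreover have "W \<subseteq> topspace (subtopology spectrum_top (spec_D (sinv s * s)))"
    using assms by (auto simp: topspace_spectrum_top spec_D_def)
  ultimately show ?thesis
    using homeomorphic_map_compactness_eq[OF homeomorphic_map_germ[of s], of W] assms
    by (simp add: compactin_subtopology)
qed

section \<open>The image lies in the groupoid algebra\<close>

text \<open>The slice of \<open>s\<close> serves as the open Hausdorff set: it is a copy of the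
  compact space \<open>spec_D (sinv s * s)\<close>, and \<open>Theta s\<close> is constantly 1 on
  it.\<close>

lemma Theta_in_generators: "Theta s \<in> ga_generators universal_groupoid"
proof -
  let ?D = "spec_D (sinv s * s)"
  let ?A = "germ_slice s ?D"
  let ?T = "subtopology (gtop universal_groupoid) ?A"
  have A: "openin (gtop universal_groupoid) ?A"
    by (simp add: openin_germ_slice openin_spec_D)
  have "Hausdorff_space ?T"
    using homeomorphic_Hausdorff_space[OF homeomorphic_map_imp_homeomorphic_space[OF homeomorphic_map_germ[of s]]]
    by (simp add: Hausdorff_space_subtopology Hausdorff_spectrum_top)
  moreover have "continuous_map ?T (discrete_topology UNIV) (Theta s)"
    by (rule continuous_map_eq[of _ _ "\<lambda>_. 1"]) (auto simp: Theta_def char_fun_def)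
  moreover have "compact_space ?T"
    using homeomorphic_compact_space[OF homeomorphic_map_imp_homeomorphic_space[OF homeomorphic_map_germ[of s]]]
    by (simp add: compact_space_subtopology compactin_spec_D)
  then have "compactin ?T (?T closure_of {x \<in> ?A. Theta s x \<noteq> 0})"
    by (intro closedin_compact_space) auto
  moreover have "\<forall>x. x \<notin> ?A \<longrightarrow> Theta s x = 0" by (simp add: Theta_def char_fun_def)
  ultimately show ?thesis unfolding ga_generators_def using A by blast
qed

lemma ga_carrier_generator:
  fixes f :: "'g \<Rightarrow> 'k::{comm_ring, comm_monoid_mult}"
  assumes "f \<in> ga_generators G"
  shows "(\<lambda>x. c * f x) \<in> ga_carrier G"
  unfolding ga_carrier_def using assms
  by (auto intro!: exI[of _ "{f}"] exI[of _ "\<lambda>_. c"])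

lemma ga_carrier_zero: "(\<lambda>x. 0) \<in> ga_carrier G"
  unfolding ga_carrier_def by (auto intro!: exI[of _ "{}"])

lemma ga_carrier_add:
  assumes "f \<in> ga_carrier G" "g \<in> ga_carrier G"
  shows "(\<lambda>x. f x + g x) \<in> ga_carrier G"
proof -
  obtain A c where A: "finite A" "A \<subseteq> ga_generators G" "f = (\<lambda>x. \<Sum>a\<in>A. c a * a x)"
    using assms(1) by (auto simp: ga_carrier_def)
  obtain B d where B: "finite B" "B \<subseteq> ga_generators G" "g = (\<lambda>x. \<Sum>a\<in>B. d a * a x)"
    using assms(2) by (auto simp: ga_carrier_def)
  \<comment> \<open>A generator may occur in both combinations; its two coefficients are then
    added.\<close>
  define h where "h a = (if a \<in> A then c a else 0) + (if a \<in> B then d a else 0)" for a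
  have "(\<Sum>a\<in>A \<union> B. h a * a x) = f x + g x" for x
  proof -
    have "(\<Sum>a\<in>A \<union> B. h a * a x) =
      (\<Sum>a\<in>A \<union> B. if a \<in> A then c a * a x else 0) + (\<Sum>a\<in>A \<union> B. if a \<in> B then d a * a x else 0)"
      unfolding sum.distrib[symmetric] by (intro sum.cong) (auto simp: h_def distrib_right)
    also have "\<dots> = f x + g x"
      using A B by (simp add: sum.inter_restrict[symmetric] Int_absorb1 Int_absorb2 Int_commute)
    finally show ?thesis .
  qed
  then have "(\<lambda>x. f x + g x) = (\<lambda>x. \<Sum>a\<in>A \<union> B. h a * a x)" by simp
  then show ?thesis using A B unfolding ga_carrier_def by blast
qed

lemma ga_carrier_sum:
  assumes "\<And>i. i \<in> I \<Longrightarrow> f i \<in> ga_carrier G"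
  shows "(\<lambda>x. \<Sum>i\<in>I. f i x) \<in> ga_carrier G"
  using assms
  by (induction I rule: infinite_finite_induct) (auto intro: ga_carrier_zero ga_carrier_add)

lemma lin_Theta_in_carrier: "lin_Theta p \<in> ga_carrier universal_groupoid"
  unfolding lin_Theta_def[abs_def]
  by (intro ga_carrier_sum ga_carrier_generator Theta_in_generators)

subsection \<open>Surjectivity\<close>

text \<open>The source of a germ as a character instead of a unit arrow. All representatives of a
  germ share their second component, so the choice does not matter.\<close>

definition germ_char :: "'s::inverse_semigroup germ \<Rightarrow> 's \<Rightarrow> bool" where
  "germ_char x = snd (SOME p. p \<in> x)"

lemma germ_char_germ:
  assumes "(s, \<phi>) \<in> germ_pairs"
  shows "germ_char (germ s \<phi>) = \<phi>"
proof -
  have "(s, \<phi>) \<in> germ s \<phi>"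
    using assms equiv_class_self[OF equiv_germ_rel] by (simp add: germ_def)
  then have "(SOME p. p \<in> germ s \<phi>) \<in> germ s \<phi>" by (rule someI)
  then show ?thesis by (auto simp: germ_char_def germ_def germ_rel_def)
qed

lemma range_lin_Theta_zero: "(\<lambda>x. 0) \<in> range lin_Theta"
  by (rule range_eqI[of _ _ 0]) (simp add: lin_Theta_zero fun_eq_iff)

lemma range_lin_Theta_add:
  assumes "f \<in> range lin_Theta" "g \<in> range lin_Theta"
  shows "(\<lambda>x. f x + g x) \<in> range lin_Theta"
proof -
  obtain p q where "f = lin_Theta p" "g = lin_Theta q" using assms by auto
  then show ?thesis by (intro range_eqI[of _ _ "p + q"]) (simp add: lin_Theta_add fun_eq_iff)
qed

lemma range_lin_Theta_diff:
  assumes "f \<in> range lin_Theta" "g \<in> range lin_Theta"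
  shows "(\<lambda>x. f x - g x) \<in> range lin_Theta"
proof -
  obtain p q where "f = lin_Theta p" "g = lin_Theta q" using assms by auto
  then show ?thesis by (intro range_eqI[of _ _ "p - q"]) (simp add: lin_Theta_diff fun_eq_iff)
qed

lemma range_lin_Theta_scale:
  assumes "f \<in> range lin_Theta"
  shows "(\<lambda>x. c * f x) \<in> range lin_Theta"
proof -
  obtain p where "f = lin_Theta p" using assms by auto
  then show ?thesis by (intro range_eqI[of _ _ "sa_scale c p"]) (simp add: lin_Theta_scale fun_eq_iff)
qed

lemma range_lin_Theta_sum:
  assumes "\<And>i. i \<in> I \<Longrightarrow> f i \<in> range lin_Theta"
  shows "(\<lambda>x. \<Sum>i\<in>I. f i x) \<in> range lin_Theta"
  using assms
  by (induction I rule: infinite_finite_induct) (auto intro: range_lin_Theta_zero range_lin_Theta_add)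

lemma Theta_in_range_lin_Theta: "Theta s \<in> range lin_Theta"
  by (rule range_eqI[of _ _ "Poly_Mapping.single s 1"]) (simp add: lin_Theta_single fun_eq_iff)

section \<open>Stable sets of characters\<close>

definition restrict_src ::
  "('s::inverse_semigroup \<Rightarrow> bool) set \<Rightarrow> ('s germ \<Rightarrow> 'k::zero) \<Rightarrow> 's germ \<Rightarrow> 'k" where
  "restrict_src W f x = (if germ_char x \<in> W then f x else 0)"

text \<open>The \<open>itself\<close> argument fixes the coefficient ring, which does not occur in
  the type of \<open>W\<close>.\<close>

definition restriction_stable ::
  "'k::{comm_ring, comm_monoid_mult} itself \<Rightarrow> ('s::inverse_semigroup \<Rightarrow> bool) set \<Rightarrow> bool" where
  "restriction_stable _ W \<longleftrightarrow>
     (\<forall>p :: 's \<Rightarrow>\<^sub>0 'k. restrict_src W (lin_Theta p) \<in> range lin_Theta)"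

lemma restriction_stableI:
  assumes "\<And>p :: 's \<Rightarrow>\<^sub>0 'k. restrict_src W (lin_Theta p) \<in> range lin_Theta"
  shows "restriction_stable TYPE('k::{comm_ring, comm_monoid_mult}) (W :: ('s::inverse_semigroup \<Rightarrow> bool) set)"
  using assms by (simp add: restriction_stable_def)

lemma restriction_stableD:
  fixes f :: "'s::inverse_semigroup germ \<Rightarrow> 'k::{comm_ring, comm_monoid_mult}"
  assumes "restriction_stable TYPE('k) W" "f \<in> range lin_Theta"
  shows "restrict_src W f \<in> range lin_Theta"
  using assms by (auto simp: restriction_stable_def)

lemma restriction_stable_Int:
  assumes "restriction_stable TYPE('k::{comm_ring, comm_monoid_mult}) U" "restriction_stable TYPE('k) W"
  shows "restriction_stable TYPE('k) (U \<inter> W)"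
proof (rule restriction_stableI)
  fix p :: "'a \<Rightarrow>\<^sub>0 'k"
  have "restrict_src (U \<inter> W) (lin_Theta p) = restrict_src U (restrict_src W (lin_Theta p))"
    by (auto simp: restrict_src_def fun_eq_iff)
  then show "restrict_src (U \<inter> W) (lin_Theta p) \<in> range lin_Theta"
    using restriction_stableD[OF assms(1) restriction_stableD[OF assms(2) rangeI]] by simp
qed

lemma restriction_stable_Compl:
  assumes "restriction_stable TYPE('k::{comm_ring, comm_monoid_mult}) W"
  shows "restriction_stable TYPE('k) (- W)"
proof (rule restriction_stableI)
  fix p :: "'a \<Rightarrow>\<^sub>0 'k"
  have *: "restrict_src (- W) (lin_Theta p) = (\<lambda>x. lin_Theta p x - restrict_src W (lin_Theta p) x)"
    by (auto simp: restrict_src_def fun_eq_iff)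
  show "restrict_src (- W) (lin_Theta p) \<in> range lin_Theta"
    unfolding * by (intro range_lin_Theta_diff rangeI restriction_stableD[OF assms])
qed

lemma restriction_stable_empty: "restriction_stable TYPE('k::{comm_ring, comm_monoid_mult}) {}"
proof (rule restriction_stableI)
  fix p :: "'a \<Rightarrow>\<^sub>0 'k"
  have "restrict_src {} (lin_Theta p) = (\<lambda>x. 0)"
    by (simp add: restrict_src_def fun_eq_iff)
  then show "restrict_src {} (lin_Theta p) \<in> range lin_Theta"
    using range_lin_Theta_zero by simp
qed

lemma restriction_stable_Union:
  assumes "finite \<F>"
    "\<And>W. W \<in> \<F> \<Longrightarrow> restriction_stable TYPE('k::{comm_ring, comm_monoid_mult}) W"
  shows "restriction_stable TYPE('k) (\<Union>\<F>)"
  using assms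
proof (induction \<F>)
  case empty
  show ?case using restriction_stable_empty by simp
next
  case (insert W \<F>)
  \<comment> \<open>De Morgan reduces unions to complements and intersections.\<close>
  have "\<Union>(insert W \<F>) = - (- W \<inter> - \<Union>\<F>)" by blast
  moreover have "restriction_stable TYPE('k) (- (- W \<inter> - \<Union>\<F>))"
    by (intro restriction_stable_Compl restriction_stable_Int) (simp_all add: insert)
  ultimately show ?case by simp
qed

text \<open>The character of every germ lies in the spectrum, and \<open>lin_Theta p\<close>
  vanishes outside the germs.\<close>

lemma restriction_stable_spectrum:
  "restriction_stable TYPE('k::{comm_ring, comm_monoid_mult}) spectrum"
proof (rule restriction_stableI)
  fix p :: "'a \<Rightarrow>\<^sub>0 'k"
  have "restrict_src spectrum (lin_Theta p) x = lin_Theta p x" for x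
  proof (cases "x \<in> germs")
    case True
    then obtain s \<phi> where "(s, \<phi>) \<in> germ_pairs" "x = germ s \<phi>" by (rule germs_cases)
    then show ?thesis by (auto simp: restrict_src_def germ_char_germ germ_pairs_def spec_D_def)
  next
    case False
    then show ?thesis by (simp add: restrict_src_def lin_Theta_outside)
  qed
  then have "restrict_src spectrum (lin_Theta p) = lin_Theta p" by (simp add: fun_eq_iff)
  then show "restrict_src spectrum (lin_Theta p) \<in> range lin_Theta" by simp
qed

text \<open>The element \<open>s * e\<close> is defined exactly where \<open>s\<close> is and
  \<open>e\<close> holds, and there it has the same germ as \<open>s\<close>.\<close>

lemma restrict_src_Theta:
  assumes "e \<in> idempotents"
  shows "restrict_src (spec_D e) (Theta s) x = Theta (s * e) x"
proof (cases "x \<in> germs")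
  case True
  then obtain t \<phi> where t: "(t, \<phi>) \<in> germ_pairs" "x = germ t \<phi>" by (rule germs_cases)
  have "germ (s * e) \<phi> = germ s \<phi>" if "(s * e, \<phi>) \<in> germ_pairs"
    using germ_nat_le(2)[OF nat_le_mult_idem[OF assms] that] by simp
  moreover have "(s * e, \<phi>) \<in> germ_pairs \<longleftrightarrow> (s, \<phi>) \<in> germ_pairs \<and> \<phi> \<in> spec_D e"
    unfolding germ_pairs_mult_idem_iff[OF assms] by (auto simp: germ_pairs_def spec_D_def)
  ultimately show ?thesis
    by (auto simp: t(2) restrict_src_def germ_char_germ[OF t(1)] Theta_germ t(1))
next
  case False
  then show ?thesis by (simp add: restrict_src_def Theta_outside)
qed

lemma restriction_stable_spec_D:
  assumes "e \<in> idempotents"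
  shows "restriction_stable TYPE('k::{comm_ring, comm_monoid_mult}) (spec_D e)"
proof (rule restriction_stableI)
  fix p :: "'a \<Rightarrow>\<^sub>0 'k"
  have "restrict_src (spec_D e) (lin_Theta p) x =
      (\<Sum>s\<in>Poly_Mapping.keys p. Poly_Mapping.lookup p s * restrict_src (spec_D e) (Theta s) x)" for x
    by (simp add: lin_Theta_def restrict_src_def)
  then have *: "restrict_src (spec_D e) (lin_Theta p) =
      (\<lambda>x. \<Sum>s\<in>Poly_Mapping.keys p. Poly_Mapping.lookup p s * Theta (s * e) x)"
    by (simp add: restrict_src_Theta[OF assms] fun_eq_iff)
  show "restrict_src (spec_D e) (lin_Theta p) \<in> range lin_Theta"
    unfolding * by (intro range_lin_Theta_sum range_lin_Theta_scale Theta_in_range_lin_Theta)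
qed

section \<open>Compact open sets of characters\<close>

text \<open>Fixing the value at one idempotent \<open>e\<close> means intersecting with
  \<open>spec_D e\<close> or with its complement in the spectrum, and both are clopen and
  stable.\<close>

lemma spectrum_cylinder:
  fixes \<phi> :: "'s::inverse_semigroup \<Rightarrow> bool"
  assumes "finite F" "F \<subseteq> idempotents"
  shows "openin spectrum_top {\<psi> \<in> spectrum. \<forall>i\<in>F. \<psi> i = \<phi> i} \<and>
    closedin spectrum_top {\<psi> \<in> spectrum. \<forall>i\<in>F. \<psi> i = \<phi> i} \<and>
    restriction_stable TYPE('k::{comm_ring, comm_monoid_mult})
      {\<psi> \<in> spectrum. \<forall>i\<in>F. \<psi> i = \<phi> i}"
  using assms
proof (induction F)
  case empty
  have "openin spectrum_top (spectrum :: ('s \<Rightarrow> bool) set)" "closedin spectrum_top (spectrum :: ('s \<Rightarrow> bool) set)"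
    using openin_topspace[of spectrum_top] closedin_topspace[of spectrum_top]
    by (simp_all only: topspace_spectrum_top)
  then show ?case using restriction_stable_spectrum by simp
next
  case (insert e F)
  let ?C = "{\<psi> \<in> spectrum. \<forall>i\<in>F. \<psi> i = \<phi> i}"
  define E where "E = (if \<phi> e then spec_D e else spectrum - spec_D e)"
  have e: "e \<in> idempotents" using insert by simp
  have "{\<psi> \<in> spectrum. \<forall>i\<in>insert e F. \<psi> i = \<phi> i} = ?C \<inter> E"
    by (auto simp: E_def spec_D_def)
  moreover have "openin spectrum_top E" "closedin spectrum_top E"
    using openin_spec_D[OF e] closedin_spec_D[OF e]
      openin_diff[OF openin_topspace closedin_spec_D[OF e]]
      closedin_diff[OF closedin_topspace openin_spec_D[OF e]]
    by (simp_all add: E_def topspace_spectrum_top)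
  moreover have "restriction_stable TYPE('k) E"
    unfolding E_def Diff_eq using restriction_stable_spec_D[OF e]
    by (auto intro: restriction_stable_Int restriction_stable_Compl restriction_stable_spectrum)
  ultimately show ?case using insert by (simp add: openin_Int closedin_Int restriction_stable_Int)
qed

text \<open>A basic open set of the product constrains finitely many coordinates, so it contains the
  cylinder of characters that agree with \<open>\<phi>\<close> there. Intersection with
  \<open>spec_D e\<close>, for some \<open>e\<close> with \<open>\<phi> e\<close>, makes the
  cylinder compact.\<close>

lemma spectrum_compact_open_nbhd:
  fixes \<phi> :: "'s::inverse_semigroup \<Rightarrow> bool"
  assumes W: "openin spectrum_top W" and \<phi>: "\<phi> \<in> W"
  obtains N where "\<phi> \<in> N" "N \<subseteq> W" "openin spectrum_top N" "compactin spectrum_top N"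
    "restriction_stable TYPE('k::{comm_ring, comm_monoid_mult}) N"
proof -
  have \<phi>s: "\<phi> \<in> spectrum" using assms openin_subset topspace_spectrum_top by blast
  then obtain e where e: "e \<in> idempotents" "\<phi> e" by (auto simp: spectrum_def)
  obtain T where T: "openin (product_topology (\<lambda>_. discrete_topology UNIV) idempotents) T" "W = T \<inter> spectrum"
    using W by (auto simp: spectrum_top_def openin_subtopology)
  then obtain U where U: "finite {i \<in> idempotents. U i \<noteq> (UNIV :: bool set)}"
      "\<phi> \<in> Pi\<^sub>E idempotents U" "Pi\<^sub>E idempotents U \<subseteq> T"
    using \<phi> by (auto simp: openin_product_topology_alt)
  define C where "C = {\<psi> \<in> spectrum. \<forall>i\<in>{i \<in> idempotents. U i \<noteq> (UNIV :: bool set)}. \<psi> i = \<phi> i}"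
  have C: "openin spectrum_top C" "closedin spectrum_top C"
    "restriction_stable TYPE('k) C"
    using spectrum_cylinder[OF U(1), of \<phi>] by (auto simp: C_def)
  have "C \<subseteq> W"
  proof
    fix \<psi> assume \<psi>: "\<psi> \<in> C"
    have "\<psi> i \<in> U i" if "i \<in> idempotents" for i
      using \<psi> that U(2) by (cases "U i = UNIV") (auto simp: C_def PiE_def Pi_def)
    then have "\<psi> \<in> Pi\<^sub>E idempotents U"
      using \<psi> by (auto simp: PiE_def C_def spectrum_def)
    then show "\<psi> \<in> W" using U(3) T(2) \<psi> by (auto simp: C_def)
  qed
  show ?thesis
  proof (rule that[of "C \<inter> spec_D e"])
    show "compactin spectrum_top (C \<inter> spec_D e)"
      by (rule closed_Int_compactin[OF C(2) compactin_spec_D[OF e(1)]])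
    show "restriction_stable TYPE('k) (C \<inter> spec_D e)"
      by (rule restriction_stable_Int[OF C(3) restriction_stable_spec_D[OF e(1)]])
    show "openin spectrum_top (C \<inter> spec_D e)"
      by (rule openin_Int[OF C(1) openin_spec_D[OF e(1)]])
    show "\<phi> \<in> C \<inter> spec_D e" using \<phi>s e by (simp add: C_def spec_D_def)
  qed (use \<open>C \<subseteq> W\<close> in blast)
qed

text \<open>By compactness \<open>W\<close> is a finite union of stable open neighbourhoods
  contained in it.\<close>

lemma restriction_stable_compact_open:
  fixes W :: "('s::inverse_semigroup \<Rightarrow> bool) set"
  assumes "openin spectrum_top W" "compactin spectrum_top W"
  shows "restriction_stable TYPE('k::{comm_ring, comm_monoid_mult}) W"
proof -
  define \<U> where "\<U> = {N. openin spectrum_top N \<and> N \<subseteq> W \<and>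
    restriction_stable TYPE('k) N}"
  have "W \<subseteq> \<Union>\<U>"
  proof
    fix \<phi> assume "\<phi> \<in> W"
    from spectrum_compact_open_nbhd[OF assms(1) this, where 'k = 'k]
    show "\<phi> \<in> \<Union>\<U>" unfolding \<U>_def by blast
  qed
  then obtain \<F> where \<F>: "finite \<F>" "\<F> \<subseteq> \<U>" "W \<subseteq> \<Union>\<F>"
    using compactinD[OF assms(2), of \<U>] by (auto simp: \<U>_def)
  then have "W = \<Union>\<F>" by (auto simp: \<U>_def)
  moreover have "restriction_stable TYPE('k) (\<Union>\<F>)"
    using \<F> by (intro restriction_stable_Union) (auto simp: \<U>_def)
  ultimately show ?thesis by simp
qed

section \<open>Compact slices and locally constant functions\<close>

text \<open>Under \<open>germ s\<close>, the set \<open>B\<close> corresponds to a compact open set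
  \<open>W\<close> of characters, and cutting \<open>Theta s\<close> down to the stable set
  \<open>W\<close> leaves the characteristic function of \<open>B\<close>.\<close>

lemma char_fun_compact_slice:
  assumes "openin (gtop universal_groupoid) B" "compactin (gtop universal_groupoid) B"
    "B \<subseteq> germ_slice s (spec_D (sinv s * s))"
  shows "(char_fun B :: 's::inverse_semigroup germ \<Rightarrow> 'k::{comm_ring, comm_monoid_mult}) \<in> range lin_Theta"
proof -
  define W where "W = {\<phi> \<in> spec_D (sinv s * s). germ s \<phi> \<in> B}"
  have W: "W \<subseteq> spec_D (sinv s * s)" by (auto simp: W_def)
  have B: "B = germ s ` W" using assms(3) by (auto simp: W_def germ_slice_def)
  have "openin spectrum_top W"
    unfolding W_def by (rule openin_germ_preimage[OF assms(1)])
  moreover have "compactin spectrum_top W"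
    using assms(2) compactin_germ_image_iff[OF W] by (simp add: B)
  ultimately have "restrict_src W (Theta s :: _ \<Rightarrow> 'k) \<in> range lin_Theta"
    by (intro restriction_stableD restriction_stable_compact_open Theta_in_range_lin_Theta)
  moreover have "restrict_src W (Theta s :: _ \<Rightarrow> 'k) = char_fun B"
  proof
    fix x
    show "restrict_src W (Theta s) x = (char_fun B x :: 'k)"
    proof (cases "x \<in> germ_slice s (spec_D (sinv s * s))")
      case True
      then obtain \<phi> where \<phi>: "\<phi> \<in> spec_D (sinv s * s)" "x = germ s \<phi>" by (auto simp: germ_slice_def)
      then have "germ_char x = \<phi>" by (simp add: germ_char_germ germ_pairs_def)
      then show ?thesis
        using True \<phi> by (simp add: restrict_src_def Theta_def char_fun_def W_def)
    next
      case False
      then show ?thesis using assms(3) by (auto simp: restrict_src_def Theta_def char_fun_def)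
    qed
  qed
  ultimately show ?thesis by simp
qed

text \<open>Peeling off one slice at a time replaces the remaining slices \<open>B\<close> by \<open>B - A\<close>, which are
  again compact because \<open>V\<close> is Hausdorff.\<close>

lemma locally_constant_in_range_lin_Theta:
  fixes f :: "'s::inverse_semigroup germ \<Rightarrow> 'k::{comm_ring, comm_monoid_mult}"
  assumes "openin (gtop universal_groupoid) V" "Hausdorff_space (subtopology (gtop universal_groupoid) V)"
    "\<And>B. B \<in> set Bs \<Longrightarrow> openin (gtop universal_groupoid) B \<and> compactin (gtop universal_groupoid) B \<and>
       B \<subseteq> V \<and> (\<exists>s. B \<subseteq> germ_slice s (spec_D (sinv s * s))) \<and> (\<exists>c. \<forall>x\<in>B. f x = c)"
    "\<And>x. x \<notin> \<Union>(set Bs) \<Longrightarrow> f x = 0"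
  shows "f \<in> range lin_Theta"
  using assms(3,4)
\<comment> \<open>Induction on the length, as every remaining member of the list changes.\<close>
proof (induction "length Bs" arbitrary: Bs f)
  case 0
  then have "f = (\<lambda>x. 0)" by (auto simp: fun_eq_iff)
  then show ?case by (simp add: range_lin_Theta_zero)
next
  case (Suc n)
  then obtain A Cs where Bs: "Bs = A # Cs" "length Cs = n" by (cases Bs) auto
  have A: "openin (gtop universal_groupoid) A" "compactin (gtop universal_groupoid) A" "A \<subseteq> V"
    using Suc.prems(1)[of A] Bs by auto
  obtain s where s: "A \<subseteq> germ_slice s (spec_D (sinv s * s))"
    using Suc.prems(1)[of A] Bs by auto
  obtain c where c: "\<forall>x\<in>A. f x = c"
    using Suc.prems(1)[of A] Bs by auto
  \<comment> \<open>The Hausdorff property makes the compact set \<open>A\<close> closed in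
    \<open>V\<close>, so that the differences \<open>B - A\<close> stay open.\<close>
  have clA: "closedin (subtopology (gtop universal_groupoid) V) A"
    using A assms(2) by (intro compactin_imp_closedin) (auto simp: compactin_subtopology)
  define g where "g x = f x - c * char_fun A x" for x
  have g: "g x = (if x \<in> A then 0 else f x)" for x using c by (simp add: g_def char_fun_def)
  have "g \<in> range lin_Theta"
  proof (rule Suc.hyps(1))
    show "n = length (map (\<lambda>B. B - A) Cs)" using Bs by simp
    show "g x = 0" if "x \<notin> \<Union>(set (map (\<lambda>B. B - A) Cs))" for x
      using that Suc.prems(2)[of x] by (auto simp: g Bs)
    fix B' assume "B' \<in> set (map (\<lambda>B. B - A) Cs)"
    then obtain B where B: "B \<in> set Bs" "B' = B - A" by (auto simp: Bs)
    note prem = Suc.prems(1)[OF B(1)]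
    have eq: "B' = (V - A) \<inter> B" using prem B(2) by blast
    have V: "V \<subseteq> topspace (gtop universal_groupoid)" using assms(1) by (rule openin_subset)
    have "openin (subtopology (gtop universal_groupoid) V) (V - A)"
      using openin_diff[OF openin_topspace clA] V by (simp add: Int_absorb1)
    then have "openin (gtop universal_groupoid) (V - A)"
      using assms(1) by (simp add: openin_open_subtopology)
    then have op: "openin (gtop universal_groupoid) B'"
      unfolding eq using prem by (intro openin_Int) auto
    \<comment> \<open>As \<open>A\<close> is also open, \<open>B'\<close> is the part of the compact
      set \<open>B\<close> in a closed subset of \<open>V\<close>.\<close>
    have "closedin (subtopology (gtop universal_groupoid) V) (V - A)"
    proof -
      have "openin (subtopology (gtop universal_groupoid) V) A"
        using A assms(1) by (simp add: openin_open_subtopology)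
      from closedin_diff[OF closedin_topspace this]
      show ?thesis using V by (simp add: Int_absorb1)
    qed
    moreover have "compactin (subtopology (gtop universal_groupoid) V) B"
      using prem by (simp add: compactin_subtopology)
    ultimately have "compactin (subtopology (gtop universal_groupoid) V) B'"
      unfolding eq by (rule closed_Int_compactin)
    then have "compactin (gtop universal_groupoid) B'" by (simp add: compactin_subtopology)
    moreover have "B' \<subseteq> V" "\<exists>s. B' \<subseteq> germ_slice s (spec_D (sinv s * s))" "\<exists>c. \<forall>x\<in>B'. g x = c"
      using prem B(2) by (auto simp: g)
    ultimately show "openin (gtop universal_groupoid) B' \<and> compactin (gtop universal_groupoid) B' \<and>
       B' \<subseteq> V \<and> (\<exists>s. B' \<subseteq> germ_slice s (spec_D (sinv s * s))) \<and> (\<exists>c. \<forall>x\<in>B'. g x = c)"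
      using op by blast
  qed
  moreover have "(\<lambda>x. c * char_fun A x) \<in> range lin_Theta"
    by (intro range_lin_Theta_scale char_fun_compact_slice[OF A(1,2) s])
  ultimately have "(\<lambda>x. g x + c * char_fun A x) \<in> range lin_Theta" by (rule range_lin_Theta_add)
  moreover have "(\<lambda>x. g x + c * char_fun A x) = f" by (simp add: g_def)
  ultimately show ?case by simp
qed

text \<open>Preimages under a continuous map to a discrete space are clopen in \<open>V\<close>.
  Hence the set where \<open>f\<close> is non-zero equals its closure and is compact, and finitely
  many compact open slices on which \<open>f\<close> is constant cover it.\<close>

lemma ga_generators_subset_range:
  fixes f :: "'s::inverse_semigroup germ \<Rightarrow> 'k::{comm_ring, comm_monoid_mult}"
  assumes "f \<in> ga_generators universal_groupoid"
  shows "f \<in> range lin_Theta"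
proof -
  let ?G = "gtop universal_groupoid"
  obtain V where V: "openin ?G V" "Hausdorff_space (subtopology ?G V)" "\<And>x. x \<notin> V \<Longrightarrow> f x = 0"
     "continuous_map (subtopology ?G V) (discrete_topology UNIV) f"
     "compactin (subtopology ?G V) (subtopology ?G V closure_of {x \<in> V. f x \<noteq> 0})"
    using assms by (auto simp: ga_generators_def)
  have topV: "topspace (subtopology ?G V) = V"
    using openin_subset[OF V(1)] by auto
  have level_open: "openin ?G {x \<in> V. f x \<in> C}" for C
    using openin_continuous_map_preimage[OF V(4), of C] unfolding topV
    by (simp add: openin_open_subtopology[OF V(1)])
  have level_closed: "closedin (subtopology ?G V) {x \<in> V. f x \<in> C}" for C
    using closedin_continuous_map_preimage[OF V(4), of C] unfolding topV by simp
  define S where "S = {x \<in> V. f x \<in> - {0}}"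
  have "subtopology ?G V closure_of S = S"
    unfolding S_def by (intro closure_of_closedin level_closed)
  then have S: "compactin ?G S"
    using V(5) by (simp add: S_def compactin_subtopology)
  define \<U> where "\<U> = {B. openin ?G B \<and> compactin ?G B \<and> B \<subseteq> V \<and>
    (\<exists>s. B \<subseteq> germ_slice s (spec_D (sinv s * s))) \<and> (\<exists>c. \<forall>x\<in>B. f x = c)}"
  have "S \<subseteq> \<Union>\<U>"
  proof
    fix x assume "x \<in> S"
    then have x: "x \<in> V" by (simp add: S_def)
    \<comment> \<open>The level set of \<open>f\<close> through \<open>x\<close> is open, so any
      slice inside it has \<open>f\<close> constant.\<close>
    define L where "L = {y \<in> V. f y \<in> {f x}}"
    have L: "openin ?G L" "x \<in> L" using level_open[of "{f x}"] x by (simp_all add: L_def)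
    then have "x \<in> germs" using openin_subset topspace_universal_groupoid by blast
    then obtain s \<phi> where s: "(s, \<phi>) \<in> germ_pairs" "x = germ s \<phi>" by (rule germs_cases)
    have "\<phi> \<in> {\<phi> \<in> spec_D (sinv s * s). germ s \<phi> \<in> L}"
      using s L by (simp add: germ_pairs_def)
    then obtain N where N: "\<phi> \<in> N" "N \<subseteq> {\<phi> \<in> spec_D (sinv s * s). germ s \<phi> \<in> L}"
      "openin spectrum_top N" "compactin spectrum_top N" "restriction_stable TYPE('k) N"
      by (rule spectrum_compact_open_nbhd[OF openin_germ_preimage[OF L(1)]])
    have ND: "N \<subseteq> spec_D (sinv s * s)" using N by auto
    have "germ_slice s N \<in> \<U>"
      unfolding \<U>_def
    proof (intro CollectI conjI)
      show "openin ?G (germ_slice s N)" by (rule openin_germ_slice[OF N(3) ND])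
      show "compactin ?G (germ_slice s N)"
        using N(4) compactin_germ_image_iff[OF ND] by (simp add: germ_slice_def)
      show "germ_slice s N \<subseteq> V" using N(2) by (auto simp: germ_slice_def L_def)
      show "\<exists>s'. germ_slice s N \<subseteq> germ_slice s' (spec_D (sinv s' * s'))"
        using ND by (auto simp: germ_slice_def)
      show "\<exists>c. \<forall>x\<in>germ_slice s N. f x = c" using N(2) by (auto simp: germ_slice_def L_def)
    qed
    then show "x \<in> \<Union>\<U>" using N(1) s(2) unfolding germ_slice_def by blast
  qed
  then obtain \<F> where \<F>: "finite \<F>" "\<F> \<subseteq> \<U>" "S \<subseteq> \<Union>\<F>"
    using compactinD[OF S, of \<U>] by (auto simp: \<U>_def)
  then obtain Bs where Bs: "set Bs = \<F>" using finite_list by blast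
  show ?thesis
  proof (rule locally_constant_in_range_lin_Theta[OF V(1,2)])
    show "f x = 0" if "x \<notin> \<Union>(set Bs)" for x
      using that \<F>(3) V(3) Bs by (auto simp: S_def)
  qed (use \<F>(2) Bs in \<open>auto simp: \<U>_def\<close>)
qed

section \<open>The isomorphism\<close>

lemma range_lin_Theta: "range lin_Theta = ga_carrier universal_groupoid"
proof (intro equalityI subsetI)
  fix f :: "'a germ \<Rightarrow> 'b" assume "f \<in> ga_carrier universal_groupoid"
  then obtain A c where "A \<subseteq> ga_generators universal_groupoid" "f = (\<lambda>x. \<Sum>a\<in>A. c a * a x)"
    by (auto simp: ga_carrier_def)
  then show "f \<in> range lin_Theta"
    using ga_generators_subset_range by (auto intro!: range_lin_Theta_sum range_lin_Theta_scale)
qed (auto intro: lin_Theta_in_carrier)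

lemma algebra_iso_lin_Theta: "algebra_iso universal_groupoid lin_Theta"
  unfolding algebra_iso_def bij_betw_def
  by (simp add: inj_lin_Theta range_lin_Theta lin_Theta_add lin_Theta_scale convolution_lin_Theta fun_eq_iff)

theorem theorem5p3:
  shows "(\<forall>s. (Theta s :: 's::inverse_semigroup germ \<Rightarrow> 'k::{comm_ring, comm_monoid_mult})
              \<in> ga_carrier universal_groupoid) \<and>
         (\<forall>s t. (Theta (s * t) :: 's germ \<Rightarrow> 'k)
              = convolution universal_groupoid (Theta s) (Theta t)) \<and>
         (\<exists>\<Phi> :: ('s \<Rightarrow>\<^sub>0 'k) \<Rightarrow> 's germ \<Rightarrow> 'k.
            algebra_iso universal_groupoid \<Phi> \<and>
            (\<forall>s. \<Phi> (Poly_Mapping.single s 1) = Theta s)) \<and>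
         (\<exists>\<Phi> :: ('s \<Rightarrow>\<^sub>0 complex) \<Rightarrow> 's germ \<Rightarrow> complex.
            algebra_iso universal_groupoid \<Phi> \<and>
            (\<forall>p. \<Phi> (sa_star p) = ga_star universal_groupoid (\<Phi> p)) \<and>
            (\<forall>s. \<Phi> (Poly_Mapping.single s 1) = Theta s))"
\<comment> \<open>The polymorphic \<open>lin_Theta\<close> is the witness over both coefficient
  rings.\<close>
proof (intro conjI allI exI[of _ lin_Theta] algebra_iso_lin_Theta lin_Theta_star)
  show "(Theta s :: 's germ \<Rightarrow> 'k) \<in> ga_carrier universal_groupoid" for s
    using Theta_in_range_lin_Theta range_lin_Theta by blast
qed (simp_all add: convolution_Theta_Theta lin_Theta_single fun_eq_iff)

end
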